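(* Let $(Y,d)$ be a complete metric space equipped with a doubling measure $\nu$, let $x_0\in Y$, and assume that $Y$ is uniformly perfect at $x_0$. Write $B_\rho=B(x_0,\rho)$. Let $1\le p<\infty$, $0<\theta<1$ and $0<R_0\le\tfrac14\operatorname{diam}Y$, with $R_0$ finite. (a) If $\theta p<\underline q_0$, then $$\operatorname{cap}_{\theta,p}(B_r,B_R)\simeq\frac{\nu(B_r)}{r^{\theta p}}\quad\text{whenever } 0<2r\le R\le R_0.\qquad(1)$$ (b) If $\theta p>\overline q_0$, then $$\operatorname{cap}_{\theta,p}(B_r,B_R)\simeq\frac{\nu(B_R)}{R^{\theta p}}\quad\text{whenever } 0<2r\le R\le R_0.\qquad(2)$$ In both cases the comparison constants in "$\simeq$" are independent of $r$ and $R$ but depend on $R_0$. Moreover, the lower bound in (1) (i.e. $\operatorname{cap}_{\theta,p}(B_r,B_R)\gtrsim\nu(B_r)/r^{\theta p}$ whenever $0<2r\le R\le R_0$) implies $\theta p\in\underline Q_0$, while the lower bound in (2) (i.e. $\operatorname{cap}_{\theta,p}(B_r,B_R)\gtrsim\nu(B_R)/R^{\theta p}$ whenever $0<2r\le R\le R_0$) implies $\theta p\in\overline Q_0$. If $p>1$, then (2) holds if and only if $\theta p>\overline q_0$.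
   Context: All metric spaces contain at least two points. $B(x,r)=\{y:d(x,y)<r\}$ are open balls. $\nu$ is a Borel measure with $0<\nu(B)<\infty$ for every ball, and it is doubling: there is $C_\nu>1$ such that $\nu(B(x,2r))\le C_\nu\,\nu(B(x,r))$ for all $x\in Y$, $r>0$. $Y$ is uniformly perfect at $x_0$ if there is a constant $\kappa>1$ such that $B(x_0,\kappa r)\setminus B(x_0,r)\ne\varnothing$ whenever $B(x_0,\kappa r)\ne Y$. Write $a\lesssim b$ if $a\le Cb$ for some constant $C>0$ independent of $r$ and $R$, $a\gtrsim b$ if $b\lesssim a$, and $a\simeq b$ if both hold. Exponent sets (at $x_0$): $$\underline Q_0=\Bigl\{q>0:\tfrac{\nu(B_r)}{\nu(B_R)}\lesssim\bigl(\tfrac rR\bigr)^q\text{ for }0<r<R\le1\Bigr\},\qquad \overline Q_0=\Bigl\{q>0:\tfrac{\nu(B_r)}{\nu(B_R)}\gtrsim\bigl(\tfrac rR\bigr)^q\text{ for }0<r<R\le1\Bigr\},$$ and $\underline q_0=\sup\underline Q_0$, $\overline q_0=\inf\overline Q_0$. $E\Subset\Omega$ means that $\overline E$ is a compact subset of $\Omega$. The Besov seminorm of a measurable function $u$ is $$[u]_{\theta,p}=\biggl(\int_Y\int_Y\frac{|u(x)-u(y)|^p}{d(x,y)^{\theta p}}\frac{d\nu(y)\,d\nu(x)}{\nu(B(x,d(x,y)))}\biggr)^{1/p},$$ the integrand being interpreted as $0$ when $x=y$. For a bounded open set $\Omega\subset Y$ and $E\Subset\Omega$, $\operatorname{cap}_{\theta,p}(E,\Omega)=\inf_u[u]_{\theta,p}^p$,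 where the infimum is over all $u$ such that $0\le u\le1$ everywhere, $u=1$ in a neighbourhood of $E$ and $\operatorname{supp}u\Subset\Omega$. *)

theory Defs
  imports "HOL-Analysis.Analysis"
begin

text \<open>
  The metric space \<open>Y\<close> is the whole type \<open>'a\<close>. Measures, integrals and capacities take values in
  \<open>ennreal\<close>.
\<close>

text \<open>The library's \<^const>\<open>diameter\<close> is real-valued, hence meaningless for unbounded spaces.\<close>

definition ediam :: "'a::metric_space set \<Rightarrow> ereal" where
  "ediam S = (SUP x\<in>S. SUP y\<in>S. ereal (dist x y))"

definition doubling_measure :: "'a::metric_space measure \<Rightarrow> bool" where
  "doubling_measure \<nu> \<longleftrightarrow>
     sets \<nu> = sets borel \<and>
     (\<forall>x r. 0 < r \<longrightarrow> 0 < emeasure \<nu> (ball x r) \<and> emeasure \<nu> (ball x r) < \<infinity>) \<and>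
     (\<exists>C::real. 1 < C \<and>
        (\<forall>x r. 0 < r \<longrightarrow> emeasure \<nu> (ball x (2 * r)) \<le> ennreal C * emeasure \<nu> (ball x r)))"

definition uniformly_perfect_at :: "'a::metric_space \<Rightarrow> bool" where
  "uniformly_perfect_at x0 \<longleftrightarrow>
     (\<exists>\<kappa>>1. \<forall>r>0. ball x0 (\<kappa> * r) \<noteq> UNIV \<longrightarrow> ball x0 (\<kappa> * r) - ball x0 r \<noteq> {})"

text \<open>
  Comparison of two functions of the radii \<open>(r, R)\<close>, ranging over \<open>S\<close>, up to a positive finite
  constant independent of \<open>(r, R)\<close>.
\<close>

definition lesssim :: "(real \<times> real) set \<Rightarrow> (real \<Rightarrow> real \<Rightarrow> ennreal) \<Rightarrow> (real \<Rightarrow> real \<Rightarrow> ennreal) \<Rightarrow> bool"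
  where "lesssim S a b \<longleftrightarrow> (\<exists>C::real. 0 < C \<and> (\<forall>(r, R)\<in>S. a r R \<le> ennreal C * b r R))"

definition gtrsim :: "(real \<times> real) set \<Rightarrow> (real \<Rightarrow> real \<Rightarrow> ennreal) \<Rightarrow> (real \<Rightarrow> real \<Rightarrow> ennreal) \<Rightarrow> bool"
  where "gtrsim S a b \<longleftrightarrow> lesssim S b a"

definition simeq :: "(real \<times> real) set \<Rightarrow> (real \<Rightarrow> real \<Rightarrow> ennreal) \<Rightarrow> (real \<Rightarrow> real \<Rightarrow> ennreal) \<Rightarrow> bool"
  where "simeq S a b \<longleftrightarrow> lesssim S a b \<and> gtrsim S a b"

definition lower_Q0 :: "'a::metric_space measure \<Rightarrow> 'a \<Rightarrow> real set" where
  "lower_Q0 \<nu> x0 =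
     {q. 0 < q \<and> lesssim {(r, R). 0 < r \<and> r < R \<and> R \<le> 1}
           (\<lambda>r R. emeasure \<nu> (ball x0 r) / emeasure \<nu> (ball x0 R))
           (\<lambda>r R. ennreal ((r / R) powr q))}"

definition upper_Q0 :: "'a::metric_space measure \<Rightarrow> 'a \<Rightarrow> real set" where
  "upper_Q0 \<nu> x0 =
     {q. 0 < q \<and> gtrsim {(r, R). 0 < r \<and> r < R \<and> R \<le> 1}
           (\<lambda>r R. emeasure \<nu> (ball x0 r) / emeasure \<nu> (ball x0 R))
           (\<lambda>r R. ennreal ((r / R) powr q))}"

definition lower_q0 :: "'a::metric_space measure \<Rightarrow> 'a \<Rightarrow> ereal" where
  "lower_q0 \<nu> x0 = (SUP q\<in>lower_Q0 \<nu> x0. ereal q)"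

definition upper_q0 :: "'a::metric_space measure \<Rightarrow> 'a \<Rightarrow> ereal" where
  "upper_q0 \<nu> x0 = (INF q\<in>upper_Q0 \<nu> x0. ereal q)"

definition compactly_inside :: "'a::topological_space set \<Rightarrow> 'a set \<Rightarrow> bool" where
  "compactly_inside E \<Omega> \<longleftrightarrow> compact (closure E) \<and> closure E \<subseteq> \<Omega>"

definition ennreal_powr :: "ennreal \<Rightarrow> real \<Rightarrow> ennreal" where
  \<comment> \<open>meant for positive exponents only\<close>
  "ennreal_powr t a = (if t = \<infinity> then \<infinity> else ennreal (enn2real t powr a))"

definition besov_seminorm ::
  "'a::metric_space measure \<Rightarrow> real \<Rightarrow> real \<Rightarrow> ('a \<Rightarrow> real) \<Rightarrow> ennreal" where
  "besov_seminorm \<nu> \<theta> p u =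
     ennreal_powr
       (\<integral>\<^sup>+x. \<integral>\<^sup>+y.
          (if x = y then 0
           else ennreal (\<bar>u x - u y\<bar> powr p / dist x y powr (\<theta> * p)) / emeasure \<nu> (ball x (dist x y)))
        \<partial>\<nu> \<partial>\<nu>)
       (1 / p)"

definition besov_cap ::
  "'a::metric_space measure \<Rightarrow> real \<Rightarrow> real \<Rightarrow> 'a set \<Rightarrow> 'a set \<Rightarrow> ennreal" where
  \<comment> \<open>meant for bounded open \<open>\<Omega>\<close> and \<open>E\<close> compactly inside \<open>\<Omega>\<close>\<close>
  "besov_cap \<nu> \<theta> p E \<Omega> =
     (INF u\<in>{u. u \<in> borel_measurable \<nu> \<and>
                (\<forall>x. 0 \<le> u x \<and> u x \<le> 1) \<and>
                (\<exists>U. open U \<and> E \<subseteq> U \<and> (\<forall>x\<in>U. u x = 1)) \<and>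
                compactly_inside {x. u x \<noteq> 0} \<Omega>}.
        ennreal_powr (besov_seminorm \<nu> \<theta> p u) p)"

end

theory Submission
  imports Defs "HOL-Probability.Probability_Measure"
begin

text \<open>
  Write \<open>dens s x r\<close> for \<open>m x r / r powr s\<close>, where \<open>m x r\<close> is the measure of the ball and \<open>s = \<theta> * p\<close>.

  Upper bounds: a Lipschitz cutoff at scale \<open>r\<close> has energy at most a constant times \<open>dens s x r\<close>, by
  summing over dyadic annuli; monotonicity of the capacity gives the same with \<open>R\<close> in place of \<open>r\<close>.

  Lower bounds: by Jensen's inequality, the averages of an admissible function over two consecutive
  balls of radii \<open>\<rho> = 2^k * r\<close> and \<open>2 * \<rho>\<close> differ by at most a constant times \<open>(energy / dens s x \<rho>) powr (1 / p)\<close>.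
  These averages pass from 1 to 0, the point supplied by uniform perfectness giving the last step.
  An exponent \<open>q \<noteq> s\<close> in the appropriate set makes \<open>dens s x \<rho>\<close> grow geometrically away from \<open>r\<close>, respectively
  from \<open>R\<close>, so that the differences can be summed.

  Conversely, comparing a lower bound with both upper bounds shows that \<open>dens s x\<close> is almost monotone, that is,
  \<open>s\<close> belongs to the exponent set. For \<open>p > 1\<close>, the logarithmic cutoff over \<open>n\<close> dyadic scales improves the
  upper bound by the factor \<open>n powr (1 - p)\<close>; hence \<open>dens s x\<close> is halved over \<open>n\<close> scales for some large \<open>n\<close>,
  which iterates to a power gain and makes the inequality \<open>s > upper_q0\<close> strict.
\<close>

section \<open>Inequalities for real powers\<close>

lemma convex_on_abs_powr:
  assumes "1 \<le> p"
  shows "convex_on UNIV (\<lambda>x::real. \<bar>x\<bar> powr p)"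
proof (rule convex_onI)
  fix t x y :: real assume t: "0 < t" "t < 1"
  \<comment> \<open>Serves the case in which one of the two points is 0; since p \<ge> 1, what
    matters there is \<open>s powr p \<le> s\<close>.\<close>
  have zero: "(s * z) powr p \<le> s * z powr p" if "0 < s" "s < 1" "0 \<le> z" for s z :: real
  proof -
    have "s powr p \<le> s powr 1" using that assms by (intro powr_mono') auto
    then show ?thesis using that by (simp add: powr_mult mult_right_mono)
  qed
  have "\<bar>(1 - t) *\<^sub>R x + t *\<^sub>R y\<bar> powr p \<le> ((1 - t) * \<bar>x\<bar> + t * \<bar>y\<bar>) powr p"
    using t assms abs_triangle_ineq[of "(1-t)*x" "t*y"] by (intro powr_mono2) (auto simp: abs_mult)
  also have "\<dots> \<le> (1 - t) * \<bar>x\<bar> powr p + t * \<bar>y\<bar> powr p"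
  proof (cases "x = 0 \<or> y = 0")
    case True
    then show ?thesis using zero[of t "\<bar>y\<bar>"] zero[of "1-t" "\<bar>x\<bar>"] t by auto
  next
    case False
    then show ?thesis using convex_onD[OF powr_convex[OF assms], of t "\<bar>x\<bar>" "\<bar>y\<bar>"] t by simp
  qed
  finally show "\<bar>(1 - t) *\<^sub>R x + t *\<^sub>R y\<bar> powr p \<le> (1 - t) * \<bar>x\<bar> powr p + t * \<bar>y\<bar> powr p" .
qed simp

text \<open>Jensen's inequality with weights \<open>a i / W\<close> at the points
  \<open>W * t i / a i\<close>; it leaves a spare factor \<open>W powr (p - 1) \<le> 1\<close>. The
  weights stay free so that they can be concentrated around a preferred index.\<close>

lemma sum_powr_le_weighted:
  fixes a t :: "'i \<Rightarrow> real"
  assumes "1 \<le> p" "finite S" "\<And>i. i \<in> S \<Longrightarrow> 0 < a i" "\<And>i. i \<in> S \<Longrightarrow> 0 \<le> t i" "(\<Sum>i\<in>S. a i) \<le> 1"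
  shows "(\<Sum>i\<in>S. t i) powr p \<le> (\<Sum>i\<in>S. a i powr (1 - p) * t i powr p)"
proof (cases "S = {}")
  case False
  define W where "W = (\<Sum>i\<in>S. a i)"
  have W: "0 < W" "W \<le> 1" using assms False by (auto simp: W_def intro!: sum_pos)
  have "(\<Sum>i\<in>S. t i) powr p = \<bar>\<Sum>i\<in>S. (a i / W) *\<^sub>R (W * t i / a i)\<bar> powr p"
  proof -
    have "(\<Sum>i\<in>S. (a i / W) *\<^sub>R (W * t i / a i)) = (\<Sum>i\<in>S. t i)"
      using W assms(3) by (intro sum.cong) (auto simp: less_imp_neq[THEN not_sym])
    then show ?thesis using assms(4) by (simp add: sum_nonneg)
  qed
  also have "\<dots> \<le> (\<Sum>i\<in>S. a i / W * \<bar>W * t i / a i\<bar> powr p)"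
    using assms False W
    by (intro convex_on_sum[OF assms(2) False convex_on_abs_powr[OF assms(1)]])
       (auto simp: W_def[symmetric] sum_divide_distrib[symmetric] less_imp_le)
  also have "\<dots> \<le> (\<Sum>i\<in>S. a i powr (1 - p) * t i powr p)"
  proof (rule sum_mono)
    fix i assume i: "i \<in> S"
    have "a i / W * \<bar>W * t i / a i\<bar> powr p = W powr (p - 1) * (a i powr (1 - p) * t i powr p)"
      using assms(3,4)[OF i] W by (simp add: powr_divide powr_mult powr_diff abs_mult field_simps)
    also have "\<dots> \<le> 1 * (a i powr (1 - p) * t i powr p)"
      using W assms(1) by (intro mult_right_mono) (auto simp: powr_le1)
    finally show "a i / W * \<bar>W * t i / a i\<bar> powr p \<le> a i powr (1 - p) * t i powr p" by simp
  qed
  finally show ?thesis .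
qed simp

lemma two_powr_neg_less_1: "0 < a \<Longrightarrow> 2 powr - a < (1::real)"
  using powr_less_cancel_iff[of 2 "-a" 0] by simp

lemma sum_powr_geometric_le:
  fixes \<delta> :: real
  assumes "0 < \<delta>"
  shows "(\<Sum>k\<le>N. 2 powr (- (real k * \<delta>))) \<le> 1 / (1 - 2 powr - \<delta>)"
proof -
  note l = two_powr_neg_less_1[OF assms]
  have "(\<Sum>k\<le>N. 2 powr (- (real k * \<delta>))) = (\<Sum>k<Suc N. (2 powr - \<delta>) ^ k)"
    by (simp add: powr_realpow[symmetric] powr_powr lessThan_Suc_atMost mult.commute)
  also have "\<dots> = (1 - (2 powr - \<delta>) ^ Suc N) / (1 - 2 powr - \<delta>)"
    using l by (subst sum_gp_strict) auto
  also have "\<dots> \<le> 1 / (1 - 2 powr - \<delta>)"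
    using l by (intro divide_right_mono) auto
  finally show ?thesis .
qed

lemma dyadic_bracket:
  fixes x :: real
  assumes "1 \<le> x"
  obtains j where "2 ^ j \<le> x" "x < 2 ^ Suc j"
proof -
  define n where "n = (LEAST n. x < 2 ^ n)"
  have n: "x < 2 ^ n"
    unfolding n_def using real_arch_pow[of 2 x] by (auto intro: LeastI_ex)
  with assms obtain j where j: "n = Suc j" by (cases n) auto
  have "\<not> x < 2 ^ j" using not_less_Least[of j "\<lambda>n. x < 2 ^ n"] j n_def by simp
  with n j show ?thesis by (intro that[of j]) auto
qed

lemma dyadic_scale_between:
  fixes r R :: real
  assumes "0 < r" "r \<le> R"
  obtains N where "R \<le> 2 ^ N * r" "2 ^ N * r \<le> 2 * R"
proof -
  obtain j where "2 ^ j \<le> R / r" "R / r < 2 ^ Suc j"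
    using dyadic_bracket[of "R / r"] assms by (auto simp: field_simps)
  then show ?thesis using assms by (intro that[of "Suc j"]) (auto simp: field_simps)
qed

text \<open>The weights are the increments of \<open>v / (1 + v)\<close> along the geometric progression
  \<open>v\<^sub>k = (t / 2^k)\<^sup>\<gamma>\<close> with \<open>\<gamma> = \<epsilon> / (p - 1)\<close>, so that they sum to at most 1, while each is at least a
  constant times \<open>min v\<^sub>k (1 / v\<^sub>k)\<close>.\<close>

lemma sum_powr_le_two_sided:
  fixes p \<epsilon> :: real
  assumes p: "1 < p" and \<epsilon>: "0 < \<epsilon>"
  shows "\<exists>A>0. \<forall>t n (d :: nat \<Rightarrow> real). 0 < t \<longrightarrow> (\<forall>k. 0 \<le> d k) \<longrightarrow>
    (\<Sum>k<n. d k) powr p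
      \<le> A * (\<Sum>k<n. ((t / 2 ^ k) powr \<epsilon> + (t / 2 ^ k) powr - \<epsilon>) * d k powr p)"
proof -
  define g where "g = \<epsilon> / (p - 1)"
  have g: "0 < g" using p \<epsilon> by (simp add: g_def)
  define l where "l = (2::real) powr - g"
  have l: "0 < l" "l < 1" using two_powr_neg_less_1[OF g] by (auto simp: l_def)
  \<comment> \<open>From \<open>1 / a k \<le> 4 / (1 - l) * max (v k) (1 / v k)\<close> raised to
    the power p - 1. Since \<open>g * (p - 1) = \<epsilon>\<close>, the powers of \<open>v k\<close>
    then become powers of \<open>t / 2 ^ k\<close> with exponents \<epsilon> and
    -\<epsilon>.\<close>
  define A where "A = (4 / (1 - l)) powr (p - 1)"
  have "(\<Sum>k<n. d k) powr p
      \<le> A * (\<Sum>k<n. ((t / 2 ^ k) powr \<epsilon> + (t / 2 ^ k) powr - \<epsilon>) * d k powr p)"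
    if t: "0 < t" and d: "\<And>k. 0 \<le> d k" for t n and d :: "nat \<Rightarrow> real"
  proof -
    define v where "v k = (t / 2 ^ k) powr g" for k :: nat
    have v: "0 < v k" for k using t by (simp add: v_def)
    have v_Suc: "v (Suc k) = l * v k" for k
    proof -
      have "t / 2 ^ Suc k = (1 / 2) * (t / 2 ^ k)" by simp
      then show ?thesis
        unfolding v_def l_def by (simp only: powr_mult) (simp add: powr_divide powr_minus field_simps)
    qed
    define a where "a k = v k * (1 - l) / ((1 + v k) * (1 + l * v k))" for k
    have a: "0 < a k" for k
      using v[of k] l unfolding a_def by (intro divide_pos_pos mult_pos_pos add_pos_pos) auto
    have a_eq: "a k = v k / (1 + v k) - v (Suc k) / (1 + v (Suc k))" for k
    proof -
      have "1 + v k \<noteq> 0" "1 + l * v k \<noteq> 0"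
        using v[of k] mult_pos_pos[OF l(1) v[of k]] by linarith+
      then show ?thesis unfolding a_def v_Suc by (simp add: field_simps)
    qed
    have "(\<Sum>k<n. a k) = v 0 / (1 + v 0) - v n / (1 + v n)"
      unfolding a_eq by (rule sum_lessThan_telescope')
    also have "\<dots> \<le> 1"
    proof -
      have "v 0 / (1 + v 0) \<le> 1" "0 \<le> v n / (1 + v n)" using v[of 0] v[of n] by auto
      then show ?thesis by linarith
    qed
    finally have "(\<Sum>k<n. d k) powr p \<le> (\<Sum>k<n. a k powr (1 - p) * d k powr p)"
      using p a d by (intro sum_powr_le_weighted) auto
    also have "\<dots> \<le> (\<Sum>k<n. A * (((t / 2 ^ k) powr \<epsilon> + (t / 2 ^ k) powr - \<epsilon>) * d k powr p))"
    proof (rule sum_mono)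
      fix k
      have "1 / a k = (1 + v k) * (1 + l * v k) / ((1 - l) * v k)"
        by (simp add: a_def mult.commute)
      also have "\<dots> \<le> (1 + v k) * (1 + v k) / ((1 - l) * v k)"
        using v[of k] l by (intro divide_right_mono mult_left_mono) auto
      also have "\<dots> \<le> 4 / (1 - l) * max (v k) (1 / v k)"
      proof -
        have "(1 + v k) * (1 + v k) \<le> 4 * (max (v k) (1 / v k) * v k)"
        proof (cases "1 \<le> v k")
          case True
          then have "(1 + v k) * (1 + v k) \<le> (2 * v k) * (2 * v k)" by (intro mult_mono) auto
          also have "\<dots> \<le> 4 * (max (v k) (1 / v k) * v k)" using v[of k] by (auto simp: mult_right_mono)
          finally show ?thesis .
        next
          case False
          then have "(1 + v k) * (1 + v k) \<le> 2 * 2" using v[of k] by (intro mult_mono) auto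
          also have "\<dots> = 4 * (1 / v k * v k)" using v[of k] by simp
          also have "\<dots> \<le> 4 * (max (v k) (1 / v k) * v k)"
            using v[of k] by (intro mult_left_mono mult_right_mono) auto
          finally show ?thesis .
        qed
        then have "(1 + v k) * (1 + v k) / ((1 - l) * v k)
            \<le> 4 * (max (v k) (1 / v k) * v k) / ((1 - l) * v k)"
          using v[of k] l by (intro divide_right_mono) auto
        also have "\<dots> = 4 / (1 - l) * max (v k) (1 / v k)" using v[of k] by simp
        finally show ?thesis .
      qed
      finally have inv: "1 / a k \<le> 4 / (1 - l) * max (v k) (1 / v k)" .
      have "a k powr (1 - p) = (1 / a k) powr (p - 1)"
        using a[of k] by (simp add: powr_divide powr_diff)
      also have "\<dots> \<le> (4 / (1 - l) * max (v k) (1 / v k)) powr (p - 1)"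
        using inv a[of k] p by (intro powr_mono2) (auto simp: less_imp_le)
      also have "\<dots> = A * max (v k) (1 / v k) powr (p - 1)"
        unfolding A_def by (rule powr_mult)
      also have "\<dots> \<le> A * (v k powr (p - 1) + (1 / v k) powr (p - 1))"
        by (intro mult_left_mono) (auto simp: max_def A_def)
      also have "v k powr (p - 1) = (t / 2 ^ k) powr \<epsilon>"
        using p by (simp add: v_def powr_powr g_def)
      also have "(1 / v k) powr (p - 1) = (t / 2 ^ k) powr - \<epsilon>"
        using p by (simp add: v_def powr_minus_divide[symmetric] powr_powr g_def)
      finally show "a k powr (1 - p) * d k powr p
          \<le> A * (((t / 2 ^ k) powr \<epsilon> + (t / 2 ^ k) powr - \<epsilon>) * d k powr p)"
        unfolding mult.assoc[symmetric] by (intro mult_right_mono) auto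
    qed
    finally show ?thesis by (simp add: sum_distrib_left)
  qed
  moreover have "0 < A" using l by (simp add: A_def)
  ultimately show ?thesis by blast
qed

lemma clamp_diff_le:
  fixes a b :: real
  shows "\<bar>max 0 (min 1 a) - max 0 (min 1 b)\<bar> \<le> min 1 \<bar>a - b\<bar>"
  by (simp add: min_def max_def)

section \<open>Almost monotone functions of the radius\<close>

text \<open>Almost decreasing positive functions are covered by passing to the reciprocal, so that
  one extension lemma serves both exponent sets.\<close>

definition almost_increasing_upto :: "real \<Rightarrow> (real \<Rightarrow> real) \<Rightarrow> bool" where
  "almost_increasing_upto M f \<longleftrightarrow> (\<exists>C>0. \<forall>r R. 0 < r \<and> r \<le> R \<and> R \<le> M \<longrightarrow> f r \<le> C * f R)"

lemma almost_increasing_uptoD: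
  assumes "almost_increasing_upto M f"
  obtains C where "0 < C" "\<And>r R. 0 < r \<Longrightarrow> r \<le> R \<Longrightarrow> R \<le> M \<Longrightarrow> f r \<le> C * f R"
  using assms unfolding almost_increasing_upto_def by blast

text \<open>Connects the exponent sets, which concern radii up to 1, with capacity estimates, which
  concern radii up to a multiple of R0. A pair of radii on both sides of M is compared through
  \<open>f M\<close>; above M the two-sided bounds suffice.\<close>

lemma almost_increasing_upto_extend:
  assumes f: "almost_increasing_upto M f" and L: "0 < L"
    and bounds: "\<And>r. M \<le> r \<Longrightarrow> r \<le> M' \<Longrightarrow> L \<le> f r \<and> f r \<le> U" and M: "0 < M"
    and pos: "\<And>r. 0 < r \<Longrightarrow> 0 < f r"
  shows "almost_increasing_upto M' f"
proof -
  obtain C where C: "0 < C" "\<And>r R. 0 < r \<Longrightarrow> r \<le> R \<Longrightarrow> R \<le> M \<Longrightarrow> f r \<le> C * f R"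
    using almost_increasing_uptoD[OF f] by blast
  \<comment> \<open>The absolute value and the summand 1 keep \<open>B\<close> positive even if
    [M, M'] is empty and \<open>U\<close> therefore unconstrained.\<close>
  define B where "B = \<bar>U\<bar> / L + 1"
  have B: "0 < B" using L by (simp add: B_def add_nonneg_pos)
  have comparable: "f r \<le> B * f R" if "M \<le> r" "r \<le> M'" "M \<le> R" "R \<le> M'" for r R
  proof -
    have "f r \<le> B * L" using bounds[of r] that L by (simp add: B_def distrib_right)
    also have "\<dots> \<le> B * f R" using bounds[of R] that B by (intro mult_left_mono) auto
    finally show ?thesis .
  qed
  have "f r \<le> (C + B + C * B) * f R" if r: "0 < r" "r \<le> R" "R \<le> M'" for r R
  proof -
    have "f r \<le> C * f R \<or> f r \<le> B * f R \<or> f r \<le> C * B * f R"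
    proof (cases "R \<le> M \<or> M \<le> r")
      case True
      then show ?thesis using C(2)[of r R] comparable[of r R] r by auto
    next
      case False
      have "f r \<le> C * f M" using False r by (intro C(2)) auto
      also have "\<dots> \<le> C * (B * f R)" using False r C(1) by (intro mult_left_mono comparable) auto
      finally show ?thesis by (simp add: mult.assoc)
    qed
    moreover have "0 \<le> C * f R" "0 \<le> B * f R" "0 \<le> C * B * f R"
      using C(1) B pos[of R] r by simp_all
    ultimately show ?thesis unfolding distrib_right by linarith
  qed
  moreover have "0 < C + B + C * B" using C B by (simp add: add_pos_pos)
  ultimately show ?thesis unfolding almost_increasing_upto_def by blast
qed

lemma ennreal_le_mult_of_mult_le:
  assumes "0 < c" "ennreal (c * F) \<le> X"
  shows "ennreal F \<le> ennreal (1 / c) * X"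
proof (cases "0 \<le> F")
  case True
  have "ennreal F = ennreal (1 / c) * ennreal (c * F)"
    using assms(1) True by (simp add: ennreal_mult[symmetric])
  also have "\<dots> \<le> ennreal (1 / c) * X" by (intro mult_left_mono assms) auto
  finally show ?thesis .
qed (simp add: ennreal_neg)

lemma lesssim_cong:
  assumes "\<And>r R. (r, R) \<in> S \<Longrightarrow> b r R = b' r R"
  shows "lesssim S a b = lesssim S a b'" "lesssim S b a = lesssim S b' a"
  unfolding lesssim_def using assms by (auto 0 3)

section \<open>Points supplied by uniform perfectness\<close>

text \<open>Uniform perfectness gives such a point as long as the enlarged ball is not the whole
  space. The diameter bound gives one point \<open>z0\<close> far from \<open>x0\<close>, which
  certifies this for small R and is itself the point for R close to R0. The factor 3/2 leaves room
  for a ball of radius R / 2 around the point, outside the ball of radius R.\<close>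

lemma exists_comparably_distant_point:
  fixes x0 :: "'a::metric_space"
  assumes up: "uniformly_perfect_at x0" and R0: "0 < R0" "ereal R0 \<le> ediam (UNIV :: 'a set) / 4"
  shows "\<exists>K>0. \<forall>R. 0 < R \<and> R \<le> R0 \<longrightarrow> (\<exists>z. 3 / 2 * R \<le> dist x0 z \<and> dist x0 z \<le> K * R)"
proof -
  obtain \<kappa> where \<kappa>: "1 < \<kappa>" "\<And>r. 0 < r \<Longrightarrow> ball x0 (\<kappa> * r) \<noteq> UNIV \<Longrightarrow> ball x0 (\<kappa> * r) - ball x0 r \<noteq> {}"
    using up unfolding uniformly_perfect_at_def by blast
  have "\<exists>z. 3 / 2 * R0 \<le> dist x0 z"
  proof (rule ccontr)
    assume "\<not> ?thesis"
    then have near: "dist x0 z \<le> 3 / 2 * R0" for z by (meson linear)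
    have "dist x y \<le> 3 * R0" for x y :: 'a
      using near[of x] near[of y] dist_triangle3[of x y x0] by linarith
    then have "ediam (UNIV :: 'a set) \<le> ereal (3 * R0)"
      unfolding ediam_def by (intro SUP_least) auto
    then have "ediam (UNIV :: 'a set) / 4 \<le> ereal (3 * R0) / 4"
      by (intro ereal_divide_right_mono) auto
    with R0 have "ereal R0 \<le> ereal (3 * R0) / 4" by (meson order_trans)
    then show False using R0 by simp
  qed
  then obtain z0 where z0: "3 / 2 * R0 \<le> dist x0 z0" by blast
  \<comment> \<open>The first entry is for \<open>\<kappa> * R \<le> R0\<close>. Otherwise R exceeds
    \<open>R0 / \<kappa>\<close>, and the second entry bounds the fixed distance to
    \<open>z0\<close> by a multiple of R.\<close>
  define K where "K = max (3 / 2 * \<kappa>) (dist x0 z0 * \<kappa> / R0)"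
  have "\<exists>z. 3 / 2 * R \<le> dist x0 z \<and> dist x0 z \<le> K * R" if R: "0 < R" "R \<le> R0" for R
  proof (cases "\<kappa> * (3 / 2 * R) \<le> 3 / 2 * R0")
    case True
    then have "z0 \<notin> ball x0 (\<kappa> * (3 / 2 * R))" using order_trans[OF True z0] by (simp add: not_less)
    then have "ball x0 (\<kappa> * (3 / 2 * R)) - ball x0 (3 / 2 * R) \<noteq> {}"
      using R by (intro \<kappa>(2)) auto
    then obtain z where "z \<in> ball x0 (\<kappa> * (3 / 2 * R)) - ball x0 (3 / 2 * R)" by blast
    then have z: "3 / 2 * R \<le> dist x0 z" "dist x0 z < 3 / 2 * \<kappa> * R" by (auto simp: mult_ac)
    have "3 / 2 * \<kappa> * R \<le> K * R" using R by (intro mult_right_mono) (auto simp: K_def)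
    with z show ?thesis by (intro exI[of _ z]) linarith
  next
    case False
    have "dist x0 z0 * 1 \<le> dist x0 z0 * (\<kappa> * R / R0)"
      using False R0 by (intro mult_left_mono) (auto simp: field_simps)
    also have "\<dots> = dist x0 z0 * \<kappa> / R0 * R" by simp
    also have "\<dots> \<le> K * R" using R by (intro mult_right_mono) (auto simp: K_def)
    finally show ?thesis using z0 R by (intro exI[of _ z0]) auto
  qed
  moreover have "0 < K" using \<kappa> by (auto simp: K_def less_max_iff_disj)
  ultimately show ?thesis by blast
qed

section \<open>Doubling measures\<close>

locale doubling_space =
  fixes \<nu> :: "'a::complete_space measure" and D :: real
  assumes sets_nu: "sets \<nu> = sets borel"
    and ball_pos: "0 < r \<Longrightarrow> 0 < emeasure \<nu> (ball x r)"
    and ball_fin: "emeasure \<nu> (ball x r) < \<infinity>"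
    and D_gt_1: "1 < D"
    and doubling: "0 < r \<Longrightarrow> emeasure \<nu> (ball x (2 * r)) \<le> ennreal D * emeasure \<nu> (ball x r)"
begin

definition m :: "'a \<Rightarrow> real \<Rightarrow> real" where "m x r = measure \<nu> (ball x r)"

lemma space_nu [simp]: "space \<nu> = UNIV"
  using sets_eq_imp_space_eq[OF sets_nu] by simp

lemma ball_in_sets [measurable]: "ball x r \<in> sets \<nu>"
  by (simp add: sets_nu)

lemma borel_measurable_nu_eq: "borel_measurable \<nu> = borel_measurable borel"
  by (rule measurable_cong_sets[OF sets_nu refl])

lemma emeasure_ball: "emeasure \<nu> (ball x r) = ennreal (m x r)"
  unfolding m_def using ball_fin[of x r] by (intro emeasure_eq_ennreal_measure) auto

lemma m_pos: "0 < r \<Longrightarrow> 0 < m x r"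
  using ball_pos[of r x] by (simp add: emeasure_ball)

lemma m_nonneg [simp]: "0 \<le> m x r"
  by (simp add: m_def)

lemma m_le_of_subset: "ball x r \<subseteq> ball y R \<Longrightarrow> m x r \<le> m y R"
  using emeasure_mono[of "ball x r" "ball y R" \<nu>] by (simp add: emeasure_ball)

lemma m_mono: "r \<le> R \<Longrightarrow> m x r \<le> m x R"
  by (intro m_le_of_subset subset_ball)

lemma m_double: "0 < r \<Longrightarrow> m x (2 * r) \<le> D * m x r"
  using doubling[of r x] D_gt_1 by (simp add: emeasure_ball ennreal_mult[symmetric])

lemma m_double_power: "0 < r \<Longrightarrow> m x (2 ^ n * r) \<le> D ^ n * m x r"
proof (induction n)
  case (Suc n)
  have "m x (2 ^ Suc n * r) \<le> D * m x (2 ^ n * r)"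
    using m_double[of "2 ^ n * r" x] Suc.prems by (simp add: mult.assoc)
  also have "\<dots> \<le> D * (D ^ n * m x r)" using Suc D_gt_1 by (intro mult_left_mono) auto
  finally show ?case by simp
qed simp

lemma m_scale: "\<exists>A\<ge>1. \<forall>x r. 0 < r \<longrightarrow> m x (K * r) \<le> A * m x r"
proof -
  obtain n where n: "K < 2 ^ n" using real_arch_pow[of 2 K] by auto
  have "m x (K * r) \<le> D ^ n * m x r" if "0 < r" for x r
    using m_mono[of "K * r" "2 ^ n * r" x] m_double_power[OF that, of x n] n that by auto
  then show ?thesis using D_gt_1 by (intro exI[of _ "D ^ n"]) auto
qed

lemma measurable_m_dist [measurable]: "(\<lambda>y. m x (dist x y)) \<in> borel_measurable \<nu>"
proof -
  have [measurable]: "m x \<in> borel_measurable borel"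
    by (intro borel_measurable_mono monoI m_mono)
  have [measurable]: "dist x \<in> borel_measurable borel"
    by (intro borel_measurable_continuous_onI continuous_intros)
  show ?thesis unfolding borel_measurable_nu_eq by measurable
qed

lemma measurable_dist_nu [measurable]: "dist x \<in> borel_measurable \<nu>"
  unfolding borel_measurable_nu_eq
  by (intro borel_measurable_continuous_onI continuous_intros)

text \<open>By doubling, the disjoint balls \<open>ball y (e / 2)\<close> all carry a fixed fraction of the measure
  of a large ball, so an \<open>e\<close>-separated set has bounded cardinality.\<close>

lemma compact_cball: "compact (cball (x::'a) R)"
proof (cases "0 < R")
  case False
  then show ?thesis by (cases "R = 0") auto
next
  case True
  have "\<exists>k. finite k \<and> cball x R \<subseteq> (\<Union>y\<in>k. ball y e)" if e: "0 < e" for e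
  proof -
    define sep where "sep F \<longleftrightarrow> finite F \<and> F \<subseteq> cball x R \<and> (\<forall>y\<in>F. \<forall>z\<in>F. y \<noteq> z \<longrightarrow> e \<le> dist y z)" for F
    \<comment> \<open>Scaling the radius e / 2 by this factor gives 2 * R + e, and a ball of that
      radius about any y in \<open>cball x R\<close> contains \<open>ball x (R + e)\<close>.\<close>
    obtain A where A: "1 \<le> A" "\<And>y r. 0 < r \<Longrightarrow> m y ((4 * R / e + 2) * r) \<le> A * m y r"
      using m_scale by blast
    define c where "c = m x (R + e)"
    have c: "0 < c" unfolding c_def using True e by (intro m_pos) auto
    have bound: "real (card F) \<le> A" if F: "sep F" for F
    proof -
      have low: "c / A \<le> m y (e / 2)" if "y \<in> F" for y
      proof -
        have "dist x y \<le> R" using F that by (auto simp: sep_def)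
        then have "dist y w < 2 * R + e" if "dist x w < R + e" for w
          using that dist_triangle[of y w x] by (simp add: dist_commute)
        then have "ball x (R + e) \<subseteq> ball y (2 * R + e)" by auto
        then have "c \<le> m y (2 * R + e)" unfolding c_def by (rule m_le_of_subset)
        also have "2 * R + e = (4 * R / e + 2) * (e / 2)" using e by (simp add: field_simps)
        also have "m y \<dots> \<le> A * m y (e / 2)" using A(2)[of "e/2" y] e by simp
        finally show ?thesis using A(1) by (simp add: field_simps)
      qed
      have "real (card F) * (c / A) \<le> (\<Sum>y\<in>F. m y (e / 2))"
        using low by (intro sum_bounded_below)
      also have "\<dots> = measure \<nu> (\<Union>y\<in>F. ball y (e / 2))"
        unfolding m_def
      proof (rule measure_finite_Union[symmetric])
        show "disjoint_family_on (\<lambda>y. ball y (e / 2)) F"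
          unfolding disjoint_family_on_def
        proof (intro ballI impI)
          fix y z assume "y \<in> F" "z \<in> F" "y \<noteq> z"
          then have "e \<le> dist y z" using F by (auto simp: sep_def)
          then have "\<not> (dist y w < e / 2 \<and> dist z w < e / 2)" for w
            using dist_triangle2[of y z w] by linarith
          then show "ball y (e / 2) \<inter> ball z (e / 2) = {}" by auto
        qed
      qed (use F ball_fin in \<open>auto simp: sep_def less_top\<close>)
      also have "\<dots> \<le> c"
        unfolding c_def m_def
      proof (rule measure_mono_fmeasurable)
        show "(\<Union>y\<in>F. ball y (e / 2)) \<subseteq> ball x (R + e)"
        proof
          fix w assume "w \<in> (\<Union>y\<in>F. ball y (e / 2))"
          then obtain y where y: "y \<in> F" "dist y w < e / 2" by auto
          then have "dist x y \<le> R" using F by (auto simp: sep_def)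
          then show "w \<in> ball x (R + e)" using y dist_triangle[of x w y] e by auto
        qed
        show "(\<Union>y\<in>F. ball y (e / 2)) \<in> sets \<nu>" unfolding sets_nu by (intro borel_open) auto
        show "ball x (R + e) \<in> fmeasurable \<nu>" using ball_fin by (intro fmeasurableI) auto
      qed
      finally show ?thesis using c A(1) by (simp add: field_simps)
    qed
    \<comment> \<open>By \<open>bound\<close> there is a separated set of largest cardinality. A
      point of the ball at distance at least e from all of it could be added, so it is an
      e-net.\<close>
    have "\<exists>F. sep F \<and> (\<forall>G. sep G \<longrightarrow> card G \<le> card F)"
    proof (rule ex_has_greatest_nat[of sep "{}" card "Suc (nat \<lceil>A\<rceil>)"])
      show "sep {}" by (simp add: sep_def)
      show "\<forall>G. sep G \<longrightarrow> card G < Suc (nat \<lceil>A\<rceil>)"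
        using order_trans[OF bound of_nat_ceiling[of A]] by (simp add: less_Suc_eq_le)
    qed
    then obtain F where F: "sep F" "\<And>G. sep G \<Longrightarrow> card G \<le> card F" by blast
    have "cball x R \<subseteq> (\<Union>y\<in>F. ball y e)"
    proof (rule ccontr)
      assume "\<not> ?thesis"
      then obtain w where w: "w \<in> cball x R" "\<And>y. y \<in> F \<Longrightarrow> e \<le> dist y w" by force
      have "w \<notin> F" using w(2)[of w] e by auto
      moreover have "sep (insert w F)"
        using F(1) w unfolding sep_def by (auto simp: dist_commute)
      ultimately show False using F(2)[of "insert w F"] F(1) by (simp add: sep_def)
    qed
    then show ?thesis using F(1) by (auto simp: sep_def)
  qed
  then show ?thesis
    unfolding compact_eq_totally_bounded by (auto simp: complete_eq_closed)
qed

lemma compactly_inside_ball: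
  assumes "\<And>y. u y \<noteq> (0::real) \<Longrightarrow> dist (x::'a) y \<le> r" "r < R"
  shows "compactly_inside {y. u y \<noteq> 0} (ball x R)"
proof -
  have "closure {y. u y \<noteq> 0} \<subseteq> cball x r"
    using assms(1) by (intro closure_minimal) auto
  moreover from this have "compact (closure {y. u y \<noteq> 0})"
    using compact_Int_closed[OF compact_cball[of x r], of "closure {y. u y \<noteq> 0}"]
    by (simp add: Int_absorb1)
  ultimately show ?thesis using assms(2) unfolding compactly_inside_def by force
qed

section \<open>Energy of cutoff functions\<close>

text \<open>Since one term of the series dominates \<open>f\<close> at each point, the whole series
  dominates it everywhere, and integrating term by term leaves a geometric series. Balls with
  overlaps thus replace disjoint annuli.\<close>

lemma nn_integral_le_geometric:
  fixes f :: "'a \<Rightarrow> real"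
  assumes "\<And>j. 0 \<le> c j" "0 < l" "l < 1"
    and dom: "\<And>y. \<exists>j. f y \<le> c j * indicator (ball x (t j)) y"
    and mass: "\<And>j. c j * m x (t j) \<le> A * l ^ j"
  shows "(\<integral>\<^sup>+y. ennreal (f y) \<partial>\<nu>) \<le> ennreal (A / (1 - l))"
proof -
  have "0 \<le> c 0 * m x (t 0)" using assms(1) by simp
  with mass[of 0] have "0 \<le> A" by simp
  have "(\<integral>\<^sup>+y. ennreal (f y) \<partial>\<nu>) \<le> (\<integral>\<^sup>+y. (\<Sum>j. ennreal (c j * indicator (ball x (t j)) y)) \<partial>\<nu>)"
  proof (rule nn_integral_mono)
    fix y
    obtain j where "f y \<le> c j * indicator (ball x (t j)) y" using dom by blast
    then have "ennreal (f y) \<le> (\<Sum>i\<in>{j}. ennreal (c i * indicator (ball x (t i)) y))"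
      by (simp add: ennreal_leI)
    also have "\<dots> \<le> (\<Sum>j. ennreal (c j * indicator (ball x (t j)) y))"
      by (rule sum_le_suminf) auto
    finally show "ennreal (f y) \<le> (\<Sum>j. ennreal (c j * indicator (ball x (t j)) y))" .
  qed
  also have "\<dots> = (\<Sum>j. \<integral>\<^sup>+y. ennreal (c j * indicator (ball x (t j)) y) \<partial>\<nu>)"
    by (intro nn_integral_suminf) measurable
  also have "\<dots> = (\<Sum>j. ennreal (c j * m x (t j)))"
  proof (intro arg_cong[where f = suminf] ext)
    fix j
    have "(\<integral>\<^sup>+y. ennreal (c j * indicator (ball x (t j)) y) \<partial>\<nu>)
        = (\<integral>\<^sup>+y. ennreal (c j) * indicator (ball x (t j)) y \<partial>\<nu>)"
      using assms(1) by (intro nn_integral_cong) (auto split: split_indicator)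
    then show "(\<integral>\<^sup>+y. ennreal (c j * indicator (ball x (t j)) y) \<partial>\<nu>) = ennreal (c j * m x (t j))"
      using assms(1) by (simp add: nn_integral_cmult_indicator emeasure_ball ennreal_mult)
  qed
  also have "\<dots> \<le> (\<Sum>j. ennreal (A * l ^ j))"
    by (intro suminf_le ennreal_leI mass) auto
  also have "\<dots> = ennreal (A / (1 - l))"
  proof (rule suminf_ennreal_eq)
    show "(\<lambda>j. A * l ^ j) sums (A / (1 - l))"
      using sums_mult[OF geometric_sums[of l], of A] assms by simp
  qed (use \<open>0 \<le> A\<close> assms in auto)
  finally show ?thesis .
qed

text \<open>On the annulus with inner radius \<open>2 ^ j * \<rho>\<close> the factor 1 / m cancels
  the mass of the annulus up to the doubling constant. What remains is
  \<open>(2 ^ j * \<rho>) powr - a\<close>, which is summable in j.\<close>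

lemma nn_integral_tail_le:
  assumes a: "0 < a"
  shows "\<exists>C>0. \<forall>x \<rho>. 0 < \<rho> \<longrightarrow>
    (\<integral>\<^sup>+y. ennreal (if \<rho> \<le> dist x y then 1 / (dist x y powr a * m x (dist x y)) else 0) \<partial>\<nu>)
      \<le> ennreal (C / \<rho> powr a)"
proof (intro exI[of _ "D / (1 - 2 powr - a)"] conjI allI impI)
  note l = two_powr_neg_less_1[OF a]
  show "0 < D / (1 - 2 powr - a)" using l D_gt_1 by simp
  fix x and \<rho> :: real assume \<rho>: "0 < \<rho>"
  define c where "c j = 1 / ((2 ^ j * \<rho>) powr a * m x (2 ^ j * \<rho>))" for j
  have "(\<integral>\<^sup>+y. ennreal (if \<rho> \<le> dist x y then 1 / (dist x y powr a * m x (dist x y)) else 0) \<partial>\<nu>)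
      \<le> ennreal (D / \<rho> powr a / (1 - 2 powr - a))"
  proof (rule nn_integral_le_geometric[where c = c and t = "\<lambda>j. 2 * (2 ^ j * \<rho>)" and x = x])
    show "0 \<le> c j" for j by (simp add: c_def)
    show "(2::real) powr - a < 1" by fact
    fix y
    show "\<exists>j. (if \<rho> \<le> dist x y then 1 / (dist x y powr a * m x (dist x y)) else 0)
        \<le> c j * indicator (ball x (2 * (2 ^ j * \<rho>))) y"
    proof (cases "\<rho> \<le> dist x y")
      case True
      obtain j where j: "2 ^ j \<le> dist x y / \<rho>" "dist x y / \<rho> < 2 ^ Suc j"
        using dyadic_bracket[of "dist x y / \<rho>"] True \<rho> by (auto simp: field_simps)
      have j': "2 ^ j * \<rho> \<le> dist x y" "dist x y < 2 * (2 ^ j * \<rho>)"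
        using j \<rho> by (auto simp: field_simps)
      have "x \<noteq> y" using True \<rho> by auto
      then have "1 / (dist x y powr a * m x (dist x y)) \<le> c j"
        unfolding c_def using \<rho> j' a
        by (intro divide_left_mono mult_mono powr_mono2 m_mono mult_pos_pos m_pos)
           (auto simp: not_le)
      then show ?thesis using True j' by (intro exI[of _ j]) auto
    qed (auto simp: c_def)
  next
    fix j
    have "c j * m x (2 * (2 ^ j * \<rho>)) \<le> c j * (D * m x (2 ^ j * \<rho>))"
      using m_double[of "2 ^ j * \<rho>" x] \<rho> by (intro mult_left_mono) (auto simp: c_def)
    also have "\<dots> = D / (2 ^ j * \<rho>) powr a"
      using m_pos[of "2 ^ j * \<rho>" x] \<rho> by (simp add: c_def)
    also have "\<dots> = D / \<rho> powr a * (2 powr - a) ^ j"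
      using \<rho> by (simp add: powr_mult powr_minus powr_realpow[symmetric] powr_powr field_simps)
    finally show "c j * m x (2 * (2 ^ j * \<rho>)) \<le> D / \<rho> powr a * (2 powr - a) ^ j" .
  qed auto
  then show "(\<integral>\<^sup>+y. ennreal (if \<rho> \<le> dist x y then 1 / (dist x y powr a * m x (dist x y)) else 0) \<partial>\<nu>)
      \<le> ennreal (D / (1 - 2 powr - a) / \<rho> powr a)"
    by (simp only: divide_divide_eq_left mult.commute)
qed

text \<open>The counterpart for annuli shrinking towards the centre: the masses cancel in the same
  way, and the positive power of the distance makes the contributions summable.\<close>

lemma nn_integral_head_le:
  assumes b: "0 < b"
  shows "\<exists>C>0. \<forall>x \<rho>. 0 < \<rho> \<longrightarrow>
    (\<integral>\<^sup>+y. ennreal (if dist x y < \<rho> then dist x y powr b / m x (dist x y) else 0) \<partial>\<nu>)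
      \<le> ennreal (C * \<rho> powr b)"
proof (intro exI[of _ "D ^ 2 / (1 - 2 powr - b)"] conjI allI impI)
  note l = two_powr_neg_less_1[OF b]
  show "0 < D ^ 2 / (1 - 2 powr - b)" using l D_gt_1 by simp
  fix x and \<rho> :: real assume \<rho>: "0 < \<rho>"
  \<comment> \<open>The inner radius of the j-th annulus. Its outer bound \<open>2 * h j\<close> may
    be attained, so the annulus is enclosed in the open ball of radius \<open>4 * h j\<close>; this
    costs \<open>D ^ 2\<close>.\<close>
  define h where "h j = \<rho> / 2 ^ Suc j" for j
  have h: "0 < h j" for j using \<rho> by (simp add: h_def)
  define c where "c j = (2 * h j) powr b / m x (h j)" for j
  have "(\<integral>\<^sup>+y. ennreal (if dist x y < \<rho> then dist x y powr b / m x (dist x y) else 0) \<partial>\<nu>)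
      \<le> ennreal (D ^ 2 * \<rho> powr b / (1 - 2 powr - b))"
  proof (rule nn_integral_le_geometric[where c = c and t = "\<lambda>j. 2 ^ 2 * h j" and x = x])
    show "0 \<le> c j" for j by (simp add: c_def)
    show "(2::real) powr - b < 1" by fact
    fix y
    show "\<exists>j. (if dist x y < \<rho> then dist x y powr b / m x (dist x y) else 0)
        \<le> c j * indicator (ball x (2 ^ 2 * h j)) y"
    proof (cases "dist x y < \<rho> \<and> x \<noteq> y")
      case True
      obtain j where j: "2 ^ j \<le> \<rho> / dist x y" "\<rho> / dist x y < 2 ^ Suc j"
        using dyadic_bracket[of "\<rho> / dist x y"] True \<rho> by (auto simp: field_simps)
      have j': "h j \<le> dist x y" "dist x y \<le> 2 * h j"
        using j \<rho> True by (auto simp: h_def field_simps)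
      have "dist x y powr b / m x (dist x y) \<le> c j"
        unfolding c_def using \<rho> j' b h[of j]
        by (intro frac_le powr_mono2 m_mono m_pos) auto
      then show ?thesis using True j' h[of j] by (intro exI[of _ j]) auto
    qed (auto simp: c_def)
  next
    fix j
    have "c j * m x (2 ^ 2 * h j) \<le> c j * (D ^ 2 * m x (h j))"
      using m_double_power[OF h[of j], of x 2] by (intro mult_left_mono) (auto simp: c_def)
    also have "\<dots> = D ^ 2 * (\<rho> / 2 ^ j) powr b"
      using m_pos[OF h, of x j] by (simp add: c_def h_def)
    also have "\<dots> = D ^ 2 * \<rho> powr b * (2 powr - b) ^ j"
      using \<rho> by (simp add: powr_divide powr_minus powr_realpow[symmetric] powr_powr field_simps)
    finally show "c j * m x (2 ^ 2 * h j) \<le> D ^ 2 * \<rho> powr b * (2 powr - b) ^ j" .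
  qed auto
  then show "(\<integral>\<^sup>+y. ennreal (if dist x y < \<rho> then dist x y powr b / m x (dist x y) else 0) \<partial>\<nu>)
      \<le> ennreal (D ^ 2 / (1 - 2 powr - b) * \<rho> powr b)"
    by (simp only: times_divide_eq_left)
qed

text \<open>No case distinction is needed on the diagonal, where the numerator is \<open>0 powr p = 0\<close>.\<close>

definition kern :: "real \<Rightarrow> real \<Rightarrow> ('a \<Rightarrow> real) \<Rightarrow> 'a \<Rightarrow> 'a \<Rightarrow> real" where
  "kern s p u x y = \<bar>u x - u y\<bar> powr p / (dist x y powr s * m x (dist x y))"

definition energy :: "real \<Rightarrow> real \<Rightarrow> ('a \<Rightarrow> real) \<Rightarrow> ennreal" where
  "energy s p u = (\<integral>\<^sup>+x. \<integral>\<^sup>+y. ennreal (kern s p u x y) \<partial>\<nu> \<partial>\<nu>)"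

lemma kern_nonneg [simp]: "0 \<le> kern s p u x y"
  by (simp add: kern_def)

lemma measurable_kern [measurable (raw)]:
  assumes [measurable]: "u \<in> borel_measurable \<nu>"
  shows "kern s p u x \<in> borel_measurable \<nu>"
  unfolding kern_def[abs_def] by measurable

text \<open>The integral is split at distance \<rho>. Outside, the minimum is at most 1 and s > 0
  makes the tail converge; inside, the Lipschitz bound raises the exponent of the distance to p - s
  > 0.\<close>

lemma nn_integral_lipschitz_kern_le:
  assumes s: "0 < s" "s < p"
  shows "\<exists>C>0. \<forall>x \<rho>. 0 < \<rho> \<longrightarrow>
    (\<integral>\<^sup>+y. ennreal (min 1 (2 * dist x y / \<rho>) powr p / (dist x y powr s * m x (dist x y))) \<partial>\<nu>)
      \<le> ennreal (C / \<rho> powr s)"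
proof -
  obtain C1 where C1: "C1 > 0" "\<And>x \<rho>. 0 < \<rho> \<Longrightarrow>
    (\<integral>\<^sup>+y. ennreal (if \<rho> \<le> dist x y then 1 / (dist x y powr s * m x (dist x y)) else 0) \<partial>\<nu>)
      \<le> ennreal (C1 / \<rho> powr s)"
    using nn_integral_tail_le[OF s(1)] by blast
  obtain C2 where C2: "C2 > 0" "\<And>x \<rho>. 0 < \<rho> \<Longrightarrow>
    (\<integral>\<^sup>+y. ennreal (if dist x y < \<rho> then dist x y powr (p - s) / m x (dist x y) else 0) \<partial>\<nu>)
      \<le> ennreal (C2 * \<rho> powr (p - s))"
    using nn_integral_head_le[of "p - s"] s by auto
  have "(\<integral>\<^sup>+y. ennreal (min 1 (2 * dist x y / \<rho>) powr p / (dist x y powr s * m x (dist x y))) \<partial>\<nu>)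
      \<le> ennreal ((C1 + 2 powr p * C2) / \<rho> powr s)" if \<rho>: "0 < \<rho>" for x \<rho>
  proof -
    let ?t = "\<lambda>y. if \<rho> \<le> dist x y then 1 / (dist x y powr s * m x (dist x y)) else 0"
    let ?h = "\<lambda>y. if dist x y < \<rho> then dist x y powr (p - s) / m x (dist x y) else 0"
    have "(\<integral>\<^sup>+y. ennreal (min 1 (2 * dist x y / \<rho>) powr p / (dist x y powr s * m x (dist x y))) \<partial>\<nu>)
       \<le> (\<integral>\<^sup>+y. ennreal (?t y) + ennreal ((2 / \<rho>) powr p) * ennreal (?h y) \<partial>\<nu>)"
    proof (rule nn_integral_mono)
      fix y
      have "min 1 (2 * dist x y / \<rho>) powr p / (dist x y powr s * m x (dist x y))
          \<le> ?t y + (2 / \<rho>) powr p * ?h y"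
      proof (cases "\<rho> \<le> dist x y")
        case True
        have "min 1 (2 * dist x y / \<rho>) powr p \<le> 1 powr p"
          using \<rho> s by (intro powr_mono2) auto
        then show ?thesis using True by (auto intro!: divide_right_mono)
      next
        case False
        show ?thesis
        proof (cases "x = y")
          case True
          then show ?thesis using \<rho> by simp
        next
          case ne: False
          have "min 1 (2 * dist x y / \<rho>) powr p \<le> (2 / \<rho> * dist x y) powr p"
            using \<rho> s by (intro powr_mono2) auto
          then have "min 1 (2 * dist x y / \<rho>) powr p / (dist x y powr s * m x (dist x y))
            \<le> (2 / \<rho> * dist x y) powr p / (dist x y powr s * m x (dist x y))"
            by (intro divide_right_mono) auto
          also have "\<dots> = (2 / \<rho>) powr p * ?h y"
            using False ne \<rho> unfolding powr_mult[of "2 / \<rho>"] by (simp add: powr_diff)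
          finally show ?thesis using False by simp
        qed
      qed
      then show "ennreal (min 1 (2 * dist x y / \<rho>) powr p / (dist x y powr s * m x (dist x y)))
        \<le> ennreal (?t y) + ennreal ((2 / \<rho>) powr p) * ennreal (?h y)"
        by (simp add: ennreal_mult[symmetric] ennreal_plus[symmetric] del: ennreal_plus)
    qed
    also have "\<dots> = (\<integral>\<^sup>+y. ennreal (?t y) \<partial>\<nu>) + ennreal ((2 / \<rho>) powr p) * (\<integral>\<^sup>+y. ennreal (?h y) \<partial>\<nu>)"
      by (subst nn_integral_add; (subst nn_integral_cmult)?) (measurable)
    also have "\<dots> \<le> ennreal (C1 / \<rho> powr s) + ennreal ((2 / \<rho>) powr p) * ennreal (C2 * \<rho> powr (p - s))"
      by (intro add_mono mult_left_mono C1 C2 \<rho>) auto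
    also have "\<dots> = ennreal (C1 / \<rho> powr s + (2 / \<rho>) powr p * (C2 * \<rho> powr (p - s)))"
      using C1 C2 by (simp add: ennreal_mult)
    also have "C1 / \<rho> powr s + (2 / \<rho>) powr p * (C2 * \<rho> powr (p - s)) = (C1 + 2 powr p * C2) / \<rho> powr s"
      using \<rho> by (simp add: powr_diff powr_divide field_simps)
    finally show ?thesis .
  qed
  moreover have "0 < C1 + 2 powr p * C2" using C1 C2 by (intro add_pos_nonneg) auto
  ultimately show ?thesis by blast
qed

section \<open>Lipschitz cutoffs at one scale\<close>

text \<open>The descent ends at 3/2 * \<rho> rather than 2 * \<rho>: the closed support then lies
  inside the ball of radius 2 * \<rho>, and points outside that ball keep a distance of at least
  \<rho> / 2 from the support.\<close>

definition bump :: "'a \<Rightarrow> real \<Rightarrow> 'a \<Rightarrow> real" where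
  "bump z \<rho> y = max 0 (min 1 (3 - 2 * dist z y / \<rho>))"

lemma bump_range: "0 \<le> bump z \<rho> y" "bump z \<rho> y \<le> 1"
  by (auto simp: bump_def)

lemma bump_eq_1: "0 < \<rho> \<Longrightarrow> dist z y \<le> \<rho> \<Longrightarrow> bump z \<rho> y = 1"
  by (auto simp: bump_def field_simps)

lemma bump_eq_0: "0 < \<rho> \<Longrightarrow> 3 / 2 * \<rho> \<le> dist z y \<Longrightarrow> bump z \<rho> y = 0"
  by (auto simp: bump_def field_simps)

lemma measurable_bump [measurable]: "bump z \<rho> \<in> borel_measurable \<nu>"
  unfolding bump_def[abs_def] by measurable

lemma bump_diff_le:
  assumes "0 < \<rho>"
  shows "\<bar>bump z \<rho> x - bump z \<rho> y\<bar> \<le> min 1 (2 * dist x y / \<rho>)"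
proof -
  have "2 * dist z x / \<rho> - 2 * dist z y / \<rho> = 2 * (dist z x - dist z y) / \<rho>"
    by (simp add: diff_divide_distrib)
  then have "\<bar>2 * dist z x / \<rho> - 2 * dist z y / \<rho>\<bar> = 2 * \<bar>dist z x - dist z y\<bar> / \<rho>"
    using assms by (simp only: abs_mult abs_divide abs_of_pos abs_numeral)
  also have "\<dots> \<le> 2 * dist x y / \<rho>"
    using assms abs_dist_diff_le[of x z y] by (intro divide_right_mono) (auto simp: dist_commute)
  finally have "\<bar>2 * dist z x / \<rho> - 2 * dist z y / \<rho>\<bar> \<le> 2 * dist x y / \<rho>" .
  then have "min 1 \<bar>(3 - 2 * dist z x / \<rho>) - (3 - 2 * dist z y / \<rho>)\<bar> \<le> min 1 (2 * dist x y / \<rho>)"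
    by (intro min.mono) (auto simp: abs_minus_commute)
  then show ?thesis unfolding bump_def by (rule order_trans[OF clamp_diff_le])
qed

text \<open>The inner integral is dominated by a function that is visibly measurable in the outer
  variable, so no product measurability and no Tonelli theorem are needed.\<close>

lemma bump_kern_majorant:
  assumes s: "0 < s" "s < p"
  shows "\<exists>C>0. \<forall>z \<rho>. 0 < \<rho> \<longrightarrow> (\<exists>G. G \<in> borel_measurable \<nu> \<and>
    (\<forall>x. (\<integral>\<^sup>+y. ennreal (kern s p (bump z \<rho>) x y) \<partial>\<nu>) \<le> G x) \<and>
    (\<integral>\<^sup>+x. G x \<partial>\<nu>) \<le> ennreal (C * (m z \<rho> / \<rho> powr s)))"
proof -
  obtain C1 where C1: "C1 > 0" "\<And>x \<rho>. 0 < \<rho> \<Longrightarrow>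
    (\<integral>\<^sup>+y. ennreal (min 1 (2 * dist x y / \<rho>) powr p / (dist x y powr s * m x (dist x y))) \<partial>\<nu>)
      \<le> ennreal (C1 / \<rho> powr s)"
    using nn_integral_lipschitz_kern_le[OF s] by blast
  obtain C2 where C2: "C2 > 0" "\<And>x \<rho>. 0 < \<rho> \<Longrightarrow>
    (\<integral>\<^sup>+y. ennreal (if \<rho> \<le> dist x y then 1 / (dist x y powr s * m x (dist x y)) else 0) \<partial>\<nu>)
      \<le> ennreal (C2 / \<rho> powr s)"
    using nn_integral_tail_le[OF s(1)] by blast
  \<comment> \<open>For x far from z and y in the support, \<open>dist x y\<close> is at least a
    quarter of d = \<open>dist z x\<close>, which accounts for \<open>4 powr s\<close>. The ball of
    radius d about z lies in the ball of radius 8 * (d / 4) about x, which accounts for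
    \<open>D ^ 3\<close>.\<close>
  define B where "B = 4 powr s * D ^ 3"
  have B: "0 < B" using D_gt_1 by (simp add: B_def)
  have "\<exists>G. G \<in> borel_measurable \<nu> \<and>
    (\<forall>x. (\<integral>\<^sup>+y. ennreal (kern s p (bump z \<rho>) x y) \<partial>\<nu>) \<le> G x) \<and>
    (\<integral>\<^sup>+x. G x \<partial>\<nu>) \<le> ennreal ((C1 * D + B * D * C2) * (m z \<rho> / \<rho> powr s))"
    if \<rho>: "0 < \<rho>" for z \<rho>
  proof -
    let ?t = "\<lambda>x. if \<rho> \<le> dist z x then 1 / (dist z x powr s * m z (dist z x)) else 0"
    \<comment> \<open>The first term bounds the inner integral for x within 2 * \<rho> of z. For x
      farther away only y near z contribute, and there the kernel is comparable to its value at the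
      distance of x from z; this gives the second term.\<close>
    define G where "G x = ennreal (C1 / \<rho> powr s) * indicator (ball z (2 * \<rho>)) x
      + ennreal (B * m z (2 * \<rho>)) * ennreal (?t x)" for x
    have G: "G \<in> borel_measurable \<nu>" unfolding G_def[abs_def] by measurable
    have "(\<integral>\<^sup>+y. ennreal (kern s p (bump z \<rho>) x y) \<partial>\<nu>) \<le> G x" for x
    proof (cases "dist z x < 2 * \<rho>")
      case True
      have "(\<integral>\<^sup>+y. ennreal (kern s p (bump z \<rho>) x y) \<partial>\<nu>) \<le>
        (\<integral>\<^sup>+y. ennreal (min 1 (2 * dist x y / \<rho>) powr p / (dist x y powr s * m x (dist x y))) \<partial>\<nu>)"
        unfolding kern_def using s
        by (intro nn_integral_mono ennreal_leI divide_right_mono powr_mono2 bump_diff_le \<rho>) auto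
      also have "\<dots> \<le> ennreal (C1 / \<rho> powr s)" by (rule C1(2)[OF \<rho>])
      also have "\<dots> \<le> G x" unfolding G_def using True by simp
      finally show ?thesis .
    next
      case False
      define d where "d = dist z x"
      have d: "2 * \<rho> \<le> d" "0 < d" using False \<rho> by (auto simp: d_def)
      have "(\<integral>\<^sup>+y. ennreal (kern s p (bump z \<rho>) x y) \<partial>\<nu>) \<le>
        (\<integral>\<^sup>+y. ennreal (B / (d powr s * m z d)) * indicator (ball z (2 * \<rho>)) y \<partial>\<nu>)"
      proof (rule nn_integral_mono)
        fix y
        show "ennreal (kern s p (bump z \<rho>) x y)
          \<le> ennreal (B / (d powr s * m z d)) * indicator (ball z (2 * \<rho>)) y"
        proof (cases "dist z y < 3 / 2 * \<rho>")
          case far: False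
          then have "bump z \<rho> x = 0" "bump z \<rho> y = 0" using \<rho> d by (auto intro!: bump_eq_0 simp: d_def)
          then show ?thesis by (simp add: kern_def)
        next
          case near: True
          have dy: "d / 4 \<le> dist x y"
            using near d dist_triangle[of z x y] by (simp add: d_def dist_commute)
          have "dist x w < 2 ^ 3 * (d / 4)" if "dist z w < d" for w
            using that dist_triangle[of x w z] by (simp add: d_def dist_commute)
          then have "m z d \<le> m x (2 ^ 3 * (d / 4))" by (intro m_le_of_subset) auto
          also have "\<dots> \<le> D ^ 3 * m x (d / 4)" using d by (intro m_double_power) auto
          also have "\<dots> \<le> D ^ 3 * m x (dist x y)" using dy D_gt_1 by (intro mult_left_mono m_mono) auto
          finally have mz: "m z d \<le> D ^ 3 * m x (dist x y)" .
          have "d powr s * m z d \<le> (4 * dist x y) powr s * (D ^ 3 * m x (dist x y))"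
            using dy d s mz by (intro mult_mono powr_mono2) auto
          also have "\<dots> = B * (dist x y powr s * m x (dist x y))" by (simp add: B_def powr_mult)
          finally have le: "d powr s * m z d \<le> B * (dist x y powr s * m x (dist x y))" .
          have "\<bar>bump z \<rho> x - bump z \<rho> y\<bar> powr p \<le> 1"
            using s bump_diff_le[OF \<rho>, of z x y] by (intro powr_le1) auto
          then have "kern s p (bump z \<rho>) x y \<le> 1 / (dist x y powr s * m x (dist x y))"
            unfolding kern_def by (intro divide_right_mono) auto
          also have "\<dots> \<le> B / (d powr s * m z d)"
          proof -
            have "0 < d powr s * m z d" "0 < dist x y powr s * m x (dist x y)"
              using d dy by (auto intro!: mult_pos_pos m_pos)
            then show ?thesis using le by (simp add: field_simps)
          qed
          finally show ?thesis using near \<rho> by (simp add: ennreal_leI)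
        qed
      qed
      also have "\<dots> = ennreal (B * m z (2 * \<rho>)) * ennreal (?t x)"
        using B d \<rho> by (simp add: nn_integral_cmult_indicator emeasure_ball ennreal_mult[symmetric] d_def)
      also have "\<dots> \<le> G x" by (simp add: G_def)
      finally show ?thesis .
    qed
    moreover have "(\<integral>\<^sup>+x. G x \<partial>\<nu>) \<le> ennreal ((C1 * D + B * D * C2) * (m z \<rho> / \<rho> powr s))"
    proof -
      have "(\<integral>\<^sup>+x. G x \<partial>\<nu>) = ennreal (C1 / \<rho> powr s) * emeasure \<nu> (ball z (2 * \<rho>))
          + ennreal (B * m z (2 * \<rho>)) * (\<integral>\<^sup>+x. ennreal (?t x) \<partial>\<nu>)"
        unfolding G_def by (subst nn_integral_add) (auto simp: nn_integral_cmult nn_integral_cmult_indicator)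
      also have "\<dots> \<le> ennreal (C1 / \<rho> powr s) * ennreal (m z (2 * \<rho>))
          + ennreal (B * m z (2 * \<rho>)) * ennreal (C2 / \<rho> powr s)"
        unfolding emeasure_ball by (intro add_mono mult_left_mono C2 \<rho>) auto
      also have "\<dots> = ennreal ((C1 + B * C2) / \<rho> powr s * m z (2 * \<rho>))"
        using C1 C2 B by (simp add: ennreal_mult[symmetric] ennreal_plus[symmetric] algebra_simps add_divide_distrib
            del: ennreal_plus)
      also have "\<dots> \<le> ennreal ((C1 + B * C2) / \<rho> powr s * (D * m z \<rho>))"
        using C1 C2 B by (intro ennreal_leI mult_left_mono m_double \<rho>) auto
      finally show ?thesis by (simp add: field_simps)
    qed
    ultimately show ?thesis using G by blast
  qed
  moreover have "0 < C1 * D + B * D * C2" using C1 C2 B D_gt_1 by (intro add_pos_pos) auto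
  ultimately show ?thesis by blast
qed

section \<open>Cutoff energy as an upper bound for the capacity\<close>

definition dens :: "real \<Rightarrow> 'a \<Rightarrow> real \<Rightarrow> real" where
  "dens s x r = m x r / r powr s"

lemma dens_pos: "0 < r \<Longrightarrow> 0 < dens s x r"
  by (simp add: dens_def m_pos)

lemma dens_powr_shift: "0 < r \<Longrightarrow> r powr e * dens s x r = dens (s - e) x r"
  by (simp add: dens_def powr_diff)

definition admissible :: "'a set \<Rightarrow> 'a set \<Rightarrow> ('a \<Rightarrow> real) set" where
  "admissible E \<Omega> = {u. u \<in> borel_measurable \<nu> \<and> (\<forall>x. 0 \<le> u x \<and> u x \<le> 1) \<and>
    (\<exists>U. open U \<and> E \<subseteq> U \<and> (\<forall>x\<in>U. u x = 1)) \<and> compactly_inside {x. u x \<noteq> 0} \<Omega>}"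

lemma seminorm_powr_eq_energy:
  assumes "1 \<le> p"
  shows "ennreal_powr (besov_seminorm \<nu> \<theta> p u) p = energy (\<theta> * p) p u"
proof -
  have *: "(if x = y then 0
      else ennreal (\<bar>u x - u y\<bar> powr p / dist x y powr (\<theta> * p)) / emeasure \<nu> (ball x (dist x y)))
      = ennreal (kern (\<theta> * p) p u x y)" for x y
    using m_pos[of "dist x y" x] by (simp add: kern_def emeasure_ball divide_ennreal)
  have "ennreal_powr (ennreal_powr I (1 / p)) p = I" for I
    using assms by (cases I) (auto simp: ennreal_powr_def powr_powr)
  then show ?thesis unfolding besov_seminorm_def * energy_def[symmetric] .
qed

lemma besov_cap_eq:
  "1 \<le> p \<Longrightarrow> besov_cap \<nu> \<theta> p E \<Omega> = (INF u\<in>admissible E \<Omega>. energy (\<theta> * p) p u)"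
  unfolding besov_cap_def admissible_def by (simp add: seminorm_powr_eq_energy)

lemma admissibleI:
  assumes "u \<in> borel_measurable \<nu>" "\<And>y. 0 \<le> u y \<and> u y \<le> 1"
    and "\<And>y. dist x y < r \<Longrightarrow> u y = 1" "\<And>y. t \<le> dist x y \<Longrightarrow> u y = 0" "t < R"
  shows "u \<in> admissible (ball x r) (ball x R)"
  unfolding admissible_def
proof (intro CollectI conjI exI[of _ "ball x r"])
  show "compactly_inside {y. u y \<noteq> 0} (ball x R)"
  proof (rule compactly_inside_ball[OF _ assms(5)])
    show "dist x y \<le> t" if "u y \<noteq> 0" for y
      using assms(4)[of y] that by (cases "t \<le> dist x y") auto
  qed
qed (use assms in auto)

lemma bump_energy_le:
  assumes s: "0 < s" "s < p"
  shows "\<exists>C>0. \<forall>x \<rho>. 0 < \<rho> \<longrightarrow> energy s p (bump x \<rho>) \<le> ennreal (C * dens s x \<rho>)"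
proof -
  obtain C where C: "C > 0" "\<And>z \<rho>. 0 < \<rho> \<Longrightarrow> \<exists>G. G \<in> borel_measurable \<nu> \<and>
    (\<forall>x. (\<integral>\<^sup>+y. ennreal (kern s p (bump z \<rho>) x y) \<partial>\<nu>) \<le> G x) \<and>
    (\<integral>\<^sup>+x. G x \<partial>\<nu>) \<le> ennreal (C * (m z \<rho> / \<rho> powr s))"
    using bump_kern_majorant[OF s] by blast
  have "energy s p (bump x \<rho>) \<le> ennreal (C * dens s x \<rho>)" if \<rho>: "0 < \<rho>" for x \<rho>
  proof -
    obtain G where G: "\<And>y. (\<integral>\<^sup>+z. ennreal (kern s p (bump x \<rho>) y z) \<partial>\<nu>) \<le> G y"
      "(\<integral>\<^sup>+y. G y \<partial>\<nu>) \<le> ennreal (C * (m x \<rho> / \<rho> powr s))"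
      using C(2)[OF \<rho>, of x] by blast
    have "energy s p (bump x \<rho>) \<le> (\<integral>\<^sup>+y. G y \<partial>\<nu>)"
      unfolding energy_def by (intro nn_integral_mono G)
    with G(2) show ?thesis by (simp add: dens_def)
  qed
  with C(1) show ?thesis by blast
qed

text \<open>The cutoff may be placed at any intermediate radius \<rho>. The choices r and R / 2 give
  the two upper bounds, while the freedom in \<rho> yields the converse statements about the
  exponent sets.\<close>

lemma besov_cap_le:
  assumes p: "1 \<le> p" and \<theta>: "0 < \<theta>" "\<theta> < 1"
  shows "\<exists>C>0. \<forall>x r \<rho> R. 0 < \<rho> \<and> r \<le> \<rho> \<and> 2 * \<rho> \<le> R \<longrightarrow>
    besov_cap \<nu> \<theta> p (ball x r) (ball x R) \<le> ennreal (C * dens (\<theta> * p) x \<rho>)"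
proof -
  obtain C where C: "C > 0" "\<And>x \<rho>. 0 < \<rho> \<Longrightarrow>
      energy (\<theta> * p) p (bump x \<rho>) \<le> ennreal (C * dens (\<theta> * p) x \<rho>)"
    using bump_energy_le[of "\<theta> * p" p] p \<theta> by auto
  have "besov_cap \<nu> \<theta> p (ball x r) (ball x R) \<le> ennreal (C * dens (\<theta> * p) x \<rho>)"
    if "0 < \<rho>" "r \<le> \<rho>" "2 * \<rho> \<le> R" for x r \<rho> R
  proof -
    have "bump x \<rho> \<in> admissible (ball x r) (ball x R)"
      using that by (intro admissibleI[where t = "3 / 2 * \<rho>"]) (auto simp: bump_range bump_eq_1 bump_eq_0)
    then have "besov_cap \<nu> \<theta> p (ball x r) (ball x R) \<le> energy (\<theta> * p) p (bump x \<rho>)"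
      unfolding besov_cap_eq[OF p] by (rule INF_lower)
    with C(2)[of \<rho> x] that show ?thesis by (simp add: order_trans)
  qed
  with C(1) show ?thesis by blast
qed

section \<open>Logarithmic cutoffs over several dyadic scales\<close>

text \<open>A dyadic version of a cutoff linear in the logarithm of the distance: it loses 1 / n at
  each of n consecutive scales.\<close>

definition log_cutoff :: "'a \<Rightarrow> real \<Rightarrow> nat \<Rightarrow> 'a \<Rightarrow> real" where
  "log_cutoff x r n y = (\<Sum>k<n. bump x (2 ^ k * r) y) / real n"

lemma log_cutoff_admissible:
  assumes "0 < r" "0 < n"
  shows "log_cutoff x r n \<in> admissible (ball x r) (ball x (2 ^ n * r))"
\<comment> \<open>The radius at which the outermost bump, the one with k = n - 1, has
  vanished.\<close>
proof (rule admissibleI[where t = "3 / 2 * (2 ^ (n - 1) * r)"])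
  have pos: "0 < 2 ^ k * r" for k :: nat using assms by simp
  show "log_cutoff x r n \<in> borel_measurable \<nu>"
    unfolding log_cutoff_def[abs_def] by measurable
  show "0 \<le> log_cutoff x r n y \<and> log_cutoff x r n y \<le> 1" for y
    using sum_bounded_above[of "{..<n}" "\<lambda>k. bump x (2 ^ k * r) y" 1] assms
    unfolding log_cutoff_def by (auto simp: bump_range intro!: sum_nonneg divide_nonneg_nonneg)
  show "log_cutoff x r n y = 1" if "dist x y < r" for y
  proof -
    have "r \<le> 2 ^ k * r" for k :: nat using assms by simp
    then have "bump x (2 ^ k * r) y = 1" for k :: nat
      using that by (intro bump_eq_1 pos) (meson less_eq_real_def order_less_le_trans)
    then show ?thesis using assms by (simp add: log_cutoff_def)
  qed
  show "log_cutoff x r n y = 0" if "3 / 2 * (2 ^ (n - 1) * r) \<le> dist x y" for y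
  proof -
    have "bump x (2 ^ k * r) y = 0" if "k < n" for k
    proof (rule bump_eq_0[OF pos])
      have "(2::real) ^ k \<le> 2 ^ (n - 1)" using that by (intro power_increasing) auto
      then have "3 / 2 * (2 ^ k * r) \<le> 3 / 2 * (2 ^ (n - 1) * r)" using assms by simp
      then show "3 / 2 * (2 ^ k * r) \<le> dist x y"
        using \<open>3 / 2 * (2 ^ (n - 1) * r) \<le> dist x y\<close> by linarith
    qed
    then show ?thesis by (simp add: log_cutoff_def)
  qed
  show "3 / 2 * (2 ^ (n - 1) * r) < 2 ^ n * r"
    using assms by (cases n) auto
qed

text \<open>Absorbs the weights of \<open>sum_powr_le_two_sided\<close> into the kernel by changing
  its exponent, so that the one-scale estimate applies again.\<close>

lemma kern_shift:
  assumes "0 < \<rho>"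
  shows "(dist x y / \<rho>) powr e * kern s p u x y = \<rho> powr - e * kern (s - e) p u x y"
  using assms by (cases "x = y") (auto simp: kern_def powr_divide powr_diff powr_minus field_simps)

text \<open>Mainly the bumps at scales near \<open>dist x y\<close> separate x from y. The weighted
  inequality exploits this: the p-th power of the sum of differences is bounded by weighted p-th
  powers, and the weights only shift s to s - e and s + e. For comparable densities the bound is of
  order \<open>real n powr (1 - p)\<close>, whereas the triangle inequality for the seminorm would
  give no decay in n.\<close>

lemma log_cutoff_energy_le:
  assumes p: "1 < p" and s: "0 < s" "s < p"
  shows "\<exists>C>0. \<forall>x r n. 0 < r \<and> 0 < n \<longrightarrow>
    energy s p (log_cutoff x r n) \<le> ennreal (C / real n powr p * (\<Sum>k<n. dens s x (2 ^ k * r)))"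
proof -
  \<comment> \<open>Halving keeps both s - e and s + e strictly between 0 and p, as
    \<open>bump_kern_majorant\<close> requires.\<close>
  define e where "e = min s (p - s) / 2"
  have e: "0 < e" "0 < s - e" "s - e < p" "0 < s + e" "s + e < p"
  proof -
    have "0 < 2 * e" "2 * e \<le> s" "2 * e \<le> p - s" using s by (auto simp: e_def)
    then show "0 < e" "0 < s - e" "s - e < p" "0 < s + e" "s + e < p" using s by linarith+
  qed
  obtain A where A: "0 < A" "\<And>t n d. 0 < t \<Longrightarrow> (\<And>k. 0 \<le> d k) \<Longrightarrow> (\<Sum>k<n. d k) powr p
      \<le> A * (\<Sum>k<n. ((t / 2 ^ k) powr e + (t / 2 ^ k) powr - e) * d k powr p)"
    using sum_powr_le_two_sided[OF p e(1)] by blast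
  obtain C1 where C1: "C1 > 0" "\<And>z \<rho>. 0 < \<rho> \<Longrightarrow> \<exists>G. G \<in> borel_measurable \<nu> \<and>
    (\<forall>x. (\<integral>\<^sup>+y. ennreal (kern (s - e) p (bump z \<rho>) x y) \<partial>\<nu>) \<le> G x) \<and>
    (\<integral>\<^sup>+x. G x \<partial>\<nu>) \<le> ennreal (C1 * (m z \<rho> / \<rho> powr (s - e)))"
    using bump_kern_majorant[OF e(2,3)] by blast
  obtain C2 where C2: "C2 > 0" "\<And>z \<rho>. 0 < \<rho> \<Longrightarrow> \<exists>G. G \<in> borel_measurable \<nu> \<and>
    (\<forall>x. (\<integral>\<^sup>+y. ennreal (kern (s + e) p (bump z \<rho>) x y) \<partial>\<nu>) \<le> G x) \<and>
    (\<integral>\<^sup>+x. G x \<partial>\<nu>) \<le> ennreal (C2 * (m z \<rho> / \<rho> powr (s + e)))"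
    using bump_kern_majorant[OF e(4,5)] by blast
  have "energy s p (log_cutoff z r n)
      \<le> ennreal (A * (C1 + C2) / real n powr p * (\<Sum>k<n. dens s z (2 ^ k * r)))"
    if r: "0 < r" and n: "0 < n" for z r n
  proof -
    define \<rho> where "\<rho> k = 2 ^ k * r" for k :: nat
    have \<rho>: "0 < \<rho> k" for k using r by (simp add: \<rho>_def)
    define B where "B = A / real n powr p"
    have B: "0 < B" using A n by (simp add: B_def)
    define c1 where "c1 k = B * \<rho> k powr - e" for k
    define c2 where "c2 k = B * \<rho> k powr e" for k
    have c: "0 < c1 k" "0 < c2 k" for k using B \<rho>[of k] by (auto simp: c1_def c2_def)
    define b where "b k = bump z (\<rho> k)" for k
    have [measurable]: "b k \<in> borel_measurable \<nu>" for k by (simp add: b_def)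
    have "\<forall>k. \<exists>G. G \<in> borel_measurable \<nu> \<and>
      (\<forall>x. (\<integral>\<^sup>+y. ennreal (kern (s - e) p (b k) x y) \<partial>\<nu>) \<le> G x) \<and>
      (\<integral>\<^sup>+x. G x \<partial>\<nu>) \<le> ennreal (C1 * dens (s - e) z (\<rho> k))"
      using C1(2)[OF \<rho>] by (simp add: b_def dens_def)
    then obtain G1 where G1 [measurable]: "\<And>k. G1 k \<in> borel_measurable \<nu>"
      and G1_ge: "\<And>k x. (\<integral>\<^sup>+y. ennreal (kern (s - e) p (b k) x y) \<partial>\<nu>) \<le> G1 k x"
      and G1_int: "\<And>k. (\<integral>\<^sup>+x. G1 k x \<partial>\<nu>) \<le> ennreal (C1 * dens (s - e) z (\<rho> k))"
      by metis
    have "\<forall>k. \<exists>G. G \<in> borel_measurable \<nu> \<and>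
      (\<forall>x. (\<integral>\<^sup>+y. ennreal (kern (s + e) p (b k) x y) \<partial>\<nu>) \<le> G x) \<and>
      (\<integral>\<^sup>+x. G x \<partial>\<nu>) \<le> ennreal (C2 * dens (s + e) z (\<rho> k))"
      using C2(2)[OF \<rho>] by (simp add: b_def dens_def)
    then obtain G2 where G2 [measurable]: "\<And>k. G2 k \<in> borel_measurable \<nu>"
      and G2_ge: "\<And>k x. (\<integral>\<^sup>+y. ennreal (kern (s + e) p (b k) x y) \<partial>\<nu>) \<le> G2 k x"
      and G2_int: "\<And>k. (\<integral>\<^sup>+x. G2 k x \<partial>\<nu>) \<le> ennreal (C2 * dens (s + e) z (\<rho> k))"
      by metis
    have pointwise: "kern s p (log_cutoff z r n) x y
        \<le> (\<Sum>k<n. c1 k * kern (s - e) p (b k) x y + c2 k * kern (s + e) p (b k) x y)" for x y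
    proof (cases "x = y")
      case True
      then show ?thesis by (simp add: kern_def)
    next
      case False
      define w where "w = 1 / (dist x y powr s * m x (dist x y))"
      have w: "0 \<le> w" by (simp add: w_def)
      have "\<bar>log_cutoff z r n x - log_cutoff z r n y\<bar> = \<bar>\<Sum>k<n. b k x - b k y\<bar> / real n"
        by (simp add: log_cutoff_def b_def \<rho>_def diff_divide_distrib[symmetric] sum_subtractf)
      also have "\<dots> \<le> (\<Sum>k<n. \<bar>b k x - b k y\<bar>) / real n"
        by (intro divide_right_mono sum_abs) auto
      finally have "\<bar>log_cutoff z r n x - log_cutoff z r n y\<bar> powr p
          \<le> ((\<Sum>k<n. \<bar>b k x - b k y\<bar>) / real n) powr p"
        using p by (intro powr_mono2) auto
      also have "\<dots> = (\<Sum>k<n. \<bar>b k x - b k y\<bar>) powr p / real n powr p"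
        by (simp add: powr_divide sum_nonneg)
      \<comment> \<open>The weighted inequality with \<open>t = dist x y / r\<close>, so that
        \<open>t / 2 ^ k\<close> measures the distance in units of the k-th radius.\<close>
      also have "\<dots> \<le> A * (\<Sum>k<n. ((dist x y / r / 2 ^ k) powr e + (dist x y / r / 2 ^ k) powr - e)
          * \<bar>b k x - b k y\<bar> powr p) / real n powr p"
        using False r by (intro divide_right_mono A(2)) auto
      also have "\<dots> = B * (\<Sum>k<n. ((dist x y / \<rho> k) powr e + (dist x y / \<rho> k) powr - e)
          * \<bar>b k x - b k y\<bar> powr p)"
        by (simp add: B_def \<rho>_def mult.commute)
      finally have le: "\<bar>log_cutoff z r n x - log_cutoff z r n y\<bar> powr p \<le> \<dots>" .
      have "kern s p (log_cutoff z r n) x y = \<bar>log_cutoff z r n x - log_cutoff z r n y\<bar> powr p * w"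
        by (simp add: kern_def w_def)
      also have "\<dots> \<le> B * (\<Sum>k<n. ((dist x y / \<rho> k) powr e + (dist x y / \<rho> k) powr - e)
          * \<bar>b k x - b k y\<bar> powr p) * w"
        by (rule mult_right_mono[OF le w])
      also have "\<dots> = (\<Sum>k<n. B * ((dist x y / \<rho> k) powr e * kern s p (b k) x y)
          + B * ((dist x y / \<rho> k) powr - e * kern s p (b k) x y))"
        unfolding sum_distrib_left sum_distrib_right
        by (intro sum.cong) (auto simp: kern_def w_def algebra_simps add_divide_distrib)
      also have "\<dots> = (\<Sum>k<n. c1 k * kern (s - e) p (b k) x y + c2 k * kern (s + e) p (b k) x y)"
        unfolding kern_shift[OF \<rho>] by (simp add: c1_def c2_def mult.assoc)
      finally show ?thesis .
    qed
    have "energy s p (log_cutoff z r n)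
      \<le> (\<integral>\<^sup>+x. (\<Sum>k<n. ennreal (c1 k) * G1 k x + ennreal (c2 k) * G2 k x) \<partial>\<nu>)"
      unfolding energy_def
    proof (rule nn_integral_mono)
      fix x
      have "(\<integral>\<^sup>+y. ennreal (kern s p (log_cutoff z r n) x y) \<partial>\<nu>)
        \<le> (\<integral>\<^sup>+y. (\<Sum>k<n. ennreal (c1 k) * ennreal (kern (s - e) p (b k) x y)
            + ennreal (c2 k) * ennreal (kern (s + e) p (b k) x y)) \<partial>\<nu>)"
      proof (rule nn_integral_mono)
        fix y
        have "ennreal (kern s p (log_cutoff z r n) x y)
          \<le> ennreal (\<Sum>k<n. c1 k * kern (s - e) p (b k) x y + c2 k * kern (s + e) p (b k) x y)"
          by (intro ennreal_leI pointwise)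
        also have "\<dots> = (\<Sum>k<n. ennreal (c1 k * kern (s - e) p (b k) x y + c2 k * kern (s + e) p (b k) x y))"
          using c[THEN less_imp_le] by (intro sum_ennreal[symmetric]) auto
        also have "\<dots> = (\<Sum>k<n. ennreal (c1 k) * ennreal (kern (s - e) p (b k) x y)
            + ennreal (c2 k) * ennreal (kern (s + e) p (b k) x y))"
          using c by (intro sum.cong) (auto simp: ennreal_mult less_imp_le)
        finally show "ennreal (kern s p (log_cutoff z r n) x y) \<le> \<dots>" .
      qed
      also have "\<dots> = (\<Sum>k<n. ennreal (c1 k) * (\<integral>\<^sup>+y. ennreal (kern (s - e) p (b k) x y) \<partial>\<nu>)
            + ennreal (c2 k) * (\<integral>\<^sup>+y. ennreal (kern (s + e) p (b k) x y) \<partial>\<nu>))"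
        by (simp add: nn_integral_sum nn_integral_add nn_integral_cmult)
      also have "\<dots> \<le> (\<Sum>k<n. ennreal (c1 k) * G1 k x + ennreal (c2 k) * G2 k x)"
        by (intro sum_mono add_mono mult_left_mono G1_ge G2_ge) auto
      finally show "(\<integral>\<^sup>+y. ennreal (kern s p (log_cutoff z r n) x y) \<partial>\<nu>) \<le> \<dots>" .
    qed
    also have "\<dots> = (\<Sum>k<n. ennreal (c1 k) * (\<integral>\<^sup>+x. G1 k x \<partial>\<nu>) + ennreal (c2 k) * (\<integral>\<^sup>+x. G2 k x \<partial>\<nu>))"
      by (simp add: nn_integral_sum nn_integral_add nn_integral_cmult)
    also have "\<dots> \<le> (\<Sum>k<n. ennreal (c1 k) * ennreal (C1 * dens (s - e) z (\<rho> k))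
        + ennreal (c2 k) * ennreal (C2 * dens (s + e) z (\<rho> k)))"
      by (intro sum_mono add_mono mult_left_mono G1_int G2_int) auto
    also have "\<dots> = (\<Sum>k<n. ennreal (B * (C1 + C2) * dens s z (\<rho> k)))"
    proof (intro sum.cong refl)
      fix k
      have d: "0 \<le> dens q z (\<rho> k)" for q using dens_pos[OF \<rho>] by (simp add: less_imp_le)
      have "c1 k * (C1 * dens (s - e) z (\<rho> k)) = B * C1 * dens s z (\<rho> k)"
        "c2 k * (C2 * dens (s + e) z (\<rho> k)) = B * C2 * dens s z (\<rho> k)"
        using dens_powr_shift[OF \<rho>, of k "-e" "s - e" z] dens_powr_shift[OF \<rho>, of k e "s + e" z]
        by (simp_all add: c1_def c2_def mult_ac)
      then have eq: "c1 k * (C1 * dens (s - e) z (\<rho> k)) + c2 k * (C2 * dens (s + e) z (\<rho> k))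
          = B * (C1 + C2) * dens s z (\<rho> k)"
        by (simp only: distrib_left distrib_right)
      show "ennreal (c1 k) * ennreal (C1 * dens (s - e) z (\<rho> k))
          + ennreal (c2 k) * ennreal (C2 * dens (s + e) z (\<rho> k)) = ennreal (B * (C1 + C2) * dens s z (\<rho> k))"
        unfolding eq[symmetric] using c[THEN less_imp_le, of k] C1(1) C2(1) d
        by (simp add: ennreal_mult ennreal_plus)
    qed
    also have "\<dots> = ennreal (\<Sum>k<n. B * (C1 + C2) * dens s z (\<rho> k))"
      using B C1(1) C2(1) dens_pos[OF \<rho>, THEN less_imp_le] by (intro sum_ennreal) auto
    also have "(\<Sum>k<n. B * (C1 + C2) * dens s z (\<rho> k))
        = A * (C1 + C2) / real n powr p * (\<Sum>k<n. dens s z (2 ^ k * r))"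
      unfolding sum_distrib_left[symmetric] by (simp add: B_def \<rho>_def)
    finally show ?thesis .
  qed
  moreover have "0 < A * (C1 + C2)" using A C1 C2 by simp
  ultimately show ?thesis by blast
qed

section \<open>Energy bounded below by differences of averages\<close>

text \<open>Written as an integral against a probability measure, so that Jensen's inequality
  applies directly.\<close>

definition avg :: "'a set \<Rightarrow> ('a \<Rightarrow> real) \<Rightarrow> real" where
  "avg S u = (\<integral>x. u x \<partial>uniform_measure \<nu> S)"

lemma avg_eq_const:
  assumes "0 < r" "\<And>y. y \<in> ball x r \<Longrightarrow> u y = c" "u \<in> borel_measurable \<nu>"
  shows "avg (ball x r) u = c"
proof -
  interpret P: prob_space "uniform_measure \<nu> (ball x r)"
    using ball_pos[OF assms(1), of x] ball_fin[of x r] by (intro prob_space_uniform_measure) auto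
  have "avg (ball x r) u = (\<integral>y. c \<partial>uniform_measure \<nu> (ball x r))"
    unfolding avg_def using assms
    by (intro integral_cong_AE AE_uniform_measureI) (auto simp: sets_nu borel_measurable_nu_eq cong: measurable_cong_sets)
  then show ?thesis by (simp add: P.prob_space[unfolded space_uniform_measure space_nu])
qed

text \<open>Jensen's inequality for the convex function \<open>\<bar>t\<bar> powr p\<close>; the
  bounds on \<open>u\<close> provide integrability.\<close>

lemma powr_avg_diff_le:
  assumes p: "1 \<le> p" and u [measurable]: "u \<in> borel_measurable \<nu>"
    and range: "\<And>y. 0 \<le> u y \<and> u y \<le> 1" and r: "0 < r"
  shows "ennreal (m x r * \<bar>avg (ball x r) u - c\<bar> powr p)
    \<le> (\<integral>\<^sup>+y. ennreal (\<bar>u y - c\<bar> powr p) * indicator (ball x r) y \<partial>\<nu>)"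
proof -
  let ?P = "uniform_measure \<nu> (ball x r)"
  interpret P: prob_space ?P
    using ball_pos[OF r, of x] ball_fin[of x r] by (intro prob_space_uniform_measure) auto
  have [measurable]: "u \<in> borel_measurable ?P" by (simp cong: measurable_cong_sets)
  have int_u: "integrable ?P u"
    using range by (intro P.integrable_const_bound[of _ 1]) auto
  have bound: "\<bar>u y - c\<bar> powr p \<le> (1 + \<bar>c\<bar>) powr p" for y
    using p range[of y] by (intro powr_mono2) auto
  have int_p: "integrable ?P (\<lambda>y. \<bar>u y - c\<bar> powr p)"
    using bound by (intro P.integrable_const_bound[of _ "(1 + \<bar>c\<bar>) powr p"]) auto
  have "avg (ball x r) u - c = P.expectation (\<lambda>y. u y - c)"
    using int_u by (simp add: avg_def P.prob_space[unfolded space_uniform_measure space_nu])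
  then have "\<bar>avg (ball x r) u - c\<bar> powr p \<le> P.expectation (\<lambda>y. \<bar>u y - c\<bar> powr p)"
    using P.jensens_inequality[of "\<lambda>y. u y - c" UNIV _ _ "\<lambda>t. \<bar>t\<bar> powr p"] int_u int_p
      convex_on_abs_powr[OF p] by simp
  then have "ennreal (\<bar>avg (ball x r) u - c\<bar> powr p) \<le> (\<integral>\<^sup>+y. ennreal (\<bar>u y - c\<bar> powr p) \<partial>?P)"
    by (subst nn_integral_eq_integral[OF int_p]) (auto intro: ennreal_leI)
  also have "\<dots> = (\<integral>\<^sup>+y. ennreal (\<bar>u y - c\<bar> powr p) * indicator (ball x r) y \<partial>\<nu>) / ennreal (m x r)"
    by (subst nn_integral_uniform_measure) (auto simp: emeasure_ball)
  finally have "ennreal (\<bar>avg (ball x r) u - c\<bar> powr p) * ennreal (m x r) \<le> \<dots> * ennreal (m x r)"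
    by (rule mult_right_mono) auto
  also have "\<dots> = (\<integral>\<^sup>+y. ennreal (\<bar>u y - c\<bar> powr p) * indicator (ball x r) y \<partial>\<nu>)"
    using m_pos[OF r, of x] by (simp add: ennreal_divide_times ennreal_times_divide[symmetric] ennreal_divide_self)
  finally show ?thesis by (simp add: ennreal_mult mult.commute)
qed

text \<open>Jensen's inequality in the second variable for fixed y, then in the first. The energy is
  restricted to the product of the two balls, where \<open>H\<close> bounds the denominator of the
  kernel.\<close>

lemma energy_ge_avg_diff:
  assumes p: "1 \<le> p" and u [measurable]: "u \<in> borel_measurable \<nu>"
    and range: "\<And>y. 0 \<le> u y \<and> u y \<le> 1" and r: "0 < r" and t: "0 < t" and H: "0 < H"
    and le_H: "\<And>y w. y \<in> ball x r \<Longrightarrow> w \<in> ball z t \<Longrightarrow> dist y w powr s * m y (dist y w) \<le> H"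
  shows "ennreal (m x r * m z t / H * \<bar>avg (ball x r) u - avg (ball z t) u\<bar> powr p) \<le> energy s p u"
proof -
  define c where "c = avg (ball z t) u"
  have inner: "ennreal (m z t / H) * ennreal (\<bar>u y - c\<bar> powr p) \<le> (\<integral>\<^sup>+w. ennreal (kern s p u y w) \<partial>\<nu>)"
    if y: "y \<in> ball x r" for y
  proof -
    have "ennreal (m z t * \<bar>c - u y\<bar> powr p)
        \<le> (\<integral>\<^sup>+w. ennreal (\<bar>u w - u y\<bar> powr p) * indicator (ball z t) w \<partial>\<nu>)"
      unfolding c_def by (rule powr_avg_diff_le[OF p u range t])
    also have "\<dots> \<le> (\<integral>\<^sup>+w. ennreal H * ennreal (kern s p u y w) \<partial>\<nu>)"
    proof (rule nn_integral_mono)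
      fix w
      have "\<bar>u w - u y\<bar> powr p \<le> H * kern s p u y w" if w: "w \<in> ball z t"
      proof (cases "y = w")
        case False
        then have pos: "0 < dist y w powr s * m y (dist y w)" by (simp add: m_pos)
        have "\<bar>u w - u y\<bar> powr p = dist y w powr s * m y (dist y w) * kern s p u y w"
          unfolding kern_def abs_minus_commute[of "u w"] using pos
          by (metis less_irrefl nonzero_mult_div_cancel_left times_divide_eq_right)
        also have "\<dots> \<le> H * kern s p u y w" by (intro mult_right_mono le_H y w) auto
        finally show ?thesis .
      qed (use H in auto)
      then show "ennreal (\<bar>u w - u y\<bar> powr p) * indicator (ball z t) w \<le> ennreal H * ennreal (kern s p u y w)"
        using H by (auto simp: ennreal_mult[symmetric] intro: ennreal_leI split: split_indicator)
    qed
    also have "\<dots> = ennreal H * (\<integral>\<^sup>+w. ennreal (kern s p u y w) \<partial>\<nu>)"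
      by (rule nn_integral_cmult) measurable
    finally have "ennreal (1 / H) * ennreal (m z t * \<bar>c - u y\<bar> powr p)
        \<le> ennreal (1 / H) * (ennreal H * (\<integral>\<^sup>+w. ennreal (kern s p u y w) \<partial>\<nu>))"
      by (rule mult_left_mono) auto
    then show ?thesis
      using H by (simp add: ennreal_mult[symmetric] mult.assoc[symmetric] abs_minus_commute)
  qed
  have "ennreal (m z t / H) * ennreal (m x r * \<bar>avg (ball x r) u - c\<bar> powr p)
      \<le> ennreal (m z t / H) * (\<integral>\<^sup>+y. ennreal (\<bar>u y - c\<bar> powr p) * indicator (ball x r) y \<partial>\<nu>)"
    by (intro mult_left_mono powr_avg_diff_le[OF p u range r]) auto
  also have "\<dots> = (\<integral>\<^sup>+y. ennreal (m z t / H) * (ennreal (\<bar>u y - c\<bar> powr p) * indicator (ball x r) y) \<partial>\<nu>)"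
    by (rule nn_integral_cmult[symmetric]) measurable
  also have "\<dots> \<le> energy s p u"
    unfolding energy_def using inner by (intro nn_integral_mono) (auto split: split_indicator)
  finally show ?thesis
    using H by (simp add: ennreal_mult[symmetric] c_def mult_ac)
qed

text \<open>For balls at the common scale r, doubling makes the denominator of the kernel at most a
  constant times \<open>r powr s * m x r\<close>. One of the two masses in the previous bound then
  cancels and the other leaves the density.\<close>

lemma energy_ge_dens_avg_diff:
  assumes p: "1 \<le> p" and s: "0 < s" and L: "1 \<le> L" and A: "0 < A"
  shows "\<exists>c>0. \<forall>x r z t u. 0 < r \<and> 0 < t \<and> ball z t \<subseteq> ball x (L * r) \<and> m x r \<le> A * m z t \<and>
    u \<in> borel_measurable \<nu> \<and> (\<forall>y. 0 \<le> u y \<and> u y \<le> 1) \<longrightarrow>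
    ennreal (c * dens s x r * \<bar>avg (ball x r) u - avg (ball z t) u\<bar> powr p) \<le> energy s p u"
proof -
  \<comment> \<open>Two points of the balls are at most (L + 1) * r apart, so the ball in the
    kernel, centred within r of x, lies in the ball of radius (L + 2) * r about x.\<close>
  obtain B where B: "1 \<le> B" "\<And>x r. 0 < r \<Longrightarrow> m x ((L + 2) * r) \<le> B * m x r"
    using m_scale by blast
  define c where "c = 1 / (A * (L + 1) powr s * B)"
  have c: "0 < c" using A L B by (simp add: c_def)
  have "ennreal (c * dens s x r * \<bar>avg (ball x r) u - avg (ball z t) u\<bar> powr p) \<le> energy s p u"
    if r: "0 < r" and t: "0 < t" and sub: "ball z t \<subseteq> ball x (L * r)" and mA: "m x r \<le> A * m z t"
      and u: "u \<in> borel_measurable \<nu>" "\<And>y. 0 \<le> u y \<and> u y \<le> 1" for x r z t u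
  proof -
    define H where "H = ((L + 1) * r) powr s * (B * m x r)"
    have H: "0 < H" using L r B by (simp add: H_def m_pos)
    have "dist y w powr s * m y (dist y w) \<le> H" if y: "y \<in> ball x r" and w: "w \<in> ball z t" for y w
    proof -
      have "dist x w < L * r" using sub w by auto
      then have d: "dist y w \<le> (L + 1) * r"
        using y dist_triangle3[of y w x] by (simp add: distrib_right)
      have "dist x v < (L + 2) * r" if "dist y v < dist y w" for v
        using that d y dist_triangle[of x v y] by (simp add: distrib_right)
      then have "m y (dist y w) \<le> m x ((L + 2) * r)" by (intro m_le_of_subset) auto
      also have "\<dots> \<le> B * m x r" by (rule B(2)[OF r])
      finally show ?thesis unfolding H_def using d s by (intro mult_mono powr_mono2) auto
    qed
    then have "ennreal (m x r * m z t / H * \<bar>avg (ball x r) u - avg (ball z t) u\<bar> powr p) \<le> energy s p u"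
      by (rule energy_ge_avg_diff[OF p u r t H])
    moreover have "c * dens s x r \<le> m x r * m z t / H"
    proof -
      have "c * dens s x r = m x r / A / ((L + 1) powr s * r powr s * B)"
        by (simp add: c_def dens_def)
      also have "\<dots> \<le> m z t / ((L + 1) powr s * r powr s * B)"
        using mA A B by (intro divide_right_mono) (auto simp: field_simps)
      also have "\<dots> = m x r * m z t / H"
        using m_pos[OF r, of x] L r by (simp add: H_def powr_mult)
      finally show ?thesis .
    qed
    ultimately show ?thesis
      by (meson order_trans ennreal_leI mult_right_mono powr_ge_zero)
  qed
  with c show ?thesis by blast
qed

text \<open>The averages of an admissible function over the balls of radius \<open>2^k * r\<close> pass from 1 to 0, the
  last step being to a ball outside \<open>ball x R\<close>. Whatever the weights, at least one of the
  increments is as large as its weighted share.\<close>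

lemma energy_ge_some_scale:
  assumes p: "1 \<le> p" and s: "0 < s" and K: "0 < K"
    and far: "\<forall>R. 0 < R \<and> R \<le> R0 \<longrightarrow> (\<exists>z. 3 / 2 * R \<le> dist x z \<and> dist x z \<le> K * R)"
  shows "\<exists>c>0. \<forall>r R N u w W. 0 < r \<and> r \<le> R \<and> R \<le> R0 \<and> R \<le> 2 ^ N * r \<and> 2 ^ N * r \<le> 2 * R \<and>
    u \<in> admissible (ball x r) (ball x R) \<and> (\<forall>k. 0 \<le> w k) \<and> (\<Sum>k\<le>N. w k) \<le> W \<and> 0 < W \<longrightarrow>
    (\<exists>k\<le>N. ennreal (c * (w k / W) powr p * dens s x (2 ^ k * r)) \<le> energy s p u)"
proof -
  \<comment> \<open>The largest ball about x has radius at most 2 * R and z is within K * R, so the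
    radius (K + 2) * R about z covers it; this is 2 * K + 4 times the radius R / 2 of the outer
    ball.\<close>
  obtain A where A: "1 \<le> A" "\<And>x r. 0 < r \<Longrightarrow> m x ((2 * K + 4) * r) \<le> A * m x r"
    using m_scale by blast
  obtain c1 where c1: "0 < c1" "\<And>x r z t u. 0 < r \<Longrightarrow> 0 < t \<Longrightarrow> ball z t \<subseteq> ball x (2 * r) \<Longrightarrow>
    m x r \<le> 1 * m z t \<Longrightarrow> u \<in> borel_measurable \<nu> \<Longrightarrow> (\<And>y. 0 \<le> u y \<and> u y \<le> 1) \<Longrightarrow>
    ennreal (c1 * dens s x r * \<bar>avg (ball x r) u - avg (ball z t) u\<bar> powr p) \<le> energy s p u"
    using energy_ge_dens_avg_diff[OF p s, of 2 1] by auto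
  obtain c2 where c2: "0 < c2" "\<And>x r z t u. 0 < r \<Longrightarrow> 0 < t \<Longrightarrow> ball z t \<subseteq> ball x ((K + 1) * r) \<Longrightarrow>
    m x r \<le> A * m z t \<Longrightarrow> u \<in> borel_measurable \<nu> \<Longrightarrow> (\<And>y. 0 \<le> u y \<and> u y \<le> 1) \<Longrightarrow>
    ennreal (c2 * dens s x r * \<bar>avg (ball x r) u - avg (ball z t) u\<bar> powr p) \<le> energy s p u"
    using energy_ge_dens_avg_diff[OF p s, of "K + 1" A] K A by auto
  define c where "c = min c1 c2"
  have "\<exists>k\<le>N. ennreal (c * (w k / W) powr p * dens s x (2 ^ k * r)) \<le> energy s p u"
    if r: "0 < r" and rR: "r \<le> R" and R0: "R \<le> R0" and N: "R \<le> 2 ^ N * r" "2 ^ N * r \<le> 2 * R"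
      and adm: "u \<in> admissible (ball x r) (ball x R)"
      and w: "\<And>k. 0 \<le> w k" and W: "(\<Sum>k\<le>N. w k) \<le> W" "0 < W" for r R N u w W
  proof -
    have u: "u \<in> borel_measurable \<nu>" "\<And>y. 0 \<le> u y \<and> u y \<le> 1"
      and u1: "\<And>y. y \<in> ball x r \<Longrightarrow> u y = 1"
      using adm by (auto simp: admissible_def)
    have u0: "u y = 0" if "R \<le> dist x y" for y
    proof (rule ccontr)
      assume "u y \<noteq> 0"
      then have "y \<in> closure {y. u y \<noteq> 0}" using closure_subset[of "{y. u y \<noteq> 0}"] by auto
      then have "y \<in> ball x R" using adm by (auto simp: admissible_def compactly_inside_def)
      with that show False by simp
    qed
    have R: "0 < R" using r rR by simp
    obtain z where z: "3 / 2 * R \<le> dist x z" "dist x z \<le> K * R" using far R R0 by blast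
    \<comment> \<open>The value 0 after index N stands for the average over
      \<open>ball z (R / 2)\<close>; there are N + 1 increments, and they telescope to 1.\<close>
    define a where "a k = (if k \<le> N then avg (ball x (2 ^ k * r)) u else 0)" for k
    have a0: "a 0 = 1" using r u u1 by (auto simp: a_def intro!: avg_eq_const)
    have last: "avg (ball z (R / 2)) u = 0"
    proof (rule avg_eq_const)
      fix y assume "y \<in> ball z (R / 2)"
      then show "u y = 0" using z(1) dist_triangle2[of x z y] by (intro u0) (simp add: dist_commute)
    qed (use R u in auto)
    have "\<exists>k\<le>N. w k / W \<le> \<bar>a k - a (Suc k)\<bar>"
    proof (rule ccontr)
      assume "\<not> ?thesis"
      then have "(\<Sum>k\<le>N. \<bar>a k - a (Suc k)\<bar>) < (\<Sum>k\<le>N. w k / W)"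
        by (intro sum_strict_mono) auto
      also have "\<dots> \<le> 1" using W by (simp add: sum_divide_distrib[symmetric])
      finally have "(\<Sum>k<Suc N. \<bar>a k - a (Suc k)\<bar>) < 1" by (simp add: lessThan_Suc_atMost)
      moreover have "\<bar>\<Sum>k<Suc N. a k - a (Suc k)\<bar> \<le> (\<Sum>k<Suc N. \<bar>a k - a (Suc k)\<bar>)" by (rule sum_abs)
      moreover have "(\<Sum>k<Suc N. a k - a (Suc k)) = a 0 - a (Suc N)" by (rule sum_lessThan_telescope')
      ultimately show False using a0 by (simp add: a_def)
    qed
    then obtain k where k: "k \<le> N" "w k / W \<le> \<bar>a k - a (Suc k)\<bar>" by blast
    have rk: "0 < 2 ^ k * r" using r by simp
    have E: "ennreal (c * dens s x (2 ^ k * r) * \<bar>a k - a (Suc k)\<bar> powr p) \<le> energy s p u"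
    proof (cases "k < N")
      case True
      have "ennreal (c * dens s x (2 ^ k * r) * \<bar>a k - a (Suc k)\<bar> powr p)
          \<le> ennreal (c1 * dens s x (2 ^ k * r) * \<bar>a k - a (Suc k)\<bar> powr p)"
        using dens_pos[OF rk] by (intro ennreal_leI mult_right_mono) (auto simp: c_def less_imp_le)
      also have "\<dots> \<le> energy s p u"
        using True c1(2)[OF rk, of "2 ^ Suc k * r" x x u] r u m_mono[of "2 ^ k * r" "2 ^ Suc k * r" x]
        by (simp add: a_def mult_ac)
      finally show ?thesis .
    next
      case False
      then have kN: "k = N" using k by simp
      have sub: "ball z (R / 2) \<subseteq> ball x ((K + 1) * (2 ^ k * r))"
      proof
        fix y assume "y \<in> ball z (R / 2)"
        then have "dist x y < (K + 1) * R"
          using z(2) R dist_triangle[of x y z] by (simp add: distrib_right)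
        also have "\<dots> \<le> (K + 1) * (2 ^ k * r)" using N K kN by (intro mult_left_mono) auto
        finally show "y \<in> ball x ((K + 1) * (2 ^ k * r))" by simp
      qed
      have "dist z y < (2 * K + 4) * (R / 2)" if "dist x y < 2 ^ N * r" for y
        using that z(2) N(2) dist_triangle3[of z y x] by (simp add: distrib_right)
      then have "m x (2 ^ k * r) \<le> m z ((2 * K + 4) * (R / 2))"
        unfolding kN by (intro m_le_of_subset) auto
      also have "\<dots> \<le> A * m z (R / 2)" using R by (intro A(2)) auto
      finally have mA: "m x (2 ^ k * r) \<le> A * m z (R / 2)" .
      have "ennreal (c * dens s x (2 ^ k * r) * \<bar>a k - a (Suc k)\<bar> powr p)
          \<le> ennreal (c2 * dens s x (2 ^ k * r) * \<bar>a k - a (Suc k)\<bar> powr p)"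
        using dens_pos[OF rk] by (intro ennreal_leI mult_right_mono) (auto simp: c_def less_imp_le)
      also have "\<dots> \<le> energy s p u"
        using c2(2)[OF rk _ sub mA u] R kN last by (simp add: a_def)
      finally show ?thesis .
    qed
    have "c * (w k / W) powr p * dens s x (2 ^ k * r)
        \<le> c * \<bar>a k - a (Suc k)\<bar> powr p * dens s x (2 ^ k * r)"
      using k(2) w W c1 c2 p dens_pos[OF rk]
      by (intro mult_right_mono mult_left_mono powr_mono2) (auto simp: c_def less_imp_le)
    then show ?thesis
      using E k(1) by (intro exI[of _ k]) (auto intro: order_trans[OF ennreal_leI] simp: mult_ac)
  qed
  moreover have "0 < c" using c1 c2 by (simp add: c_def)
  ultimately show ?thesis by blast
qed

section \<open>Exponent sets and capacity of balls\<close>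

lemma dens_bounds:
  assumes "0 < M" "0 < q"
  shows "\<exists>L>0. \<exists>U>0. \<forall>r. M \<le> r \<and> r \<le> M' \<longrightarrow> L \<le> dens q x r \<and> dens q x r \<le> U"
proof (cases "M \<le> M'")
  case True
  have "m x M / M' powr q \<le> dens q x r \<and> dens q x r \<le> m x M' / M powr q" if "M \<le> r" "r \<le> M'" for r
    unfolding dens_def using that assms by (intro conjI frac_le m_mono powr_mono2) auto
  moreover have "0 < m x M / M' powr q" "0 < m x M' / M powr q" using True assms by (auto simp: m_pos)
  ultimately show ?thesis by blast
qed (auto intro: exI[of _ 1])

lemma dens_almost_increasing_extend:
  assumes "almost_increasing_upto M (dens q x)" "0 < M" "0 < q"
  shows "almost_increasing_upto M' (dens q x)"
proof -
  obtain L U where LU: "0 < L" "\<And>r. M \<le> r \<Longrightarrow> r \<le> M' \<Longrightarrow> L \<le> dens q x r \<and> dens q x r \<le> U"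
    using dens_bounds[OF assms(2,3), of M' x] by blast
  show ?thesis by (rule almost_increasing_upto_extend[OF assms(1) LU assms(2) dens_pos])
qed

lemma dens_almost_decreasing_extend:
  assumes "almost_increasing_upto M (\<lambda>r. 1 / dens q x r)" "0 < M" "0 < q"
  shows "almost_increasing_upto M' (\<lambda>r. 1 / dens q x r)"
proof -
  obtain L U where LU: "0 < L" "0 < U"
    "\<And>r. M \<le> r \<Longrightarrow> r \<le> M' \<Longrightarrow> L \<le> dens q x r \<and> dens q x r \<le> U"
    using dens_bounds[OF assms(2,3), of M' x] by blast
  show ?thesis
  proof (rule almost_increasing_upto_extend[OF assms(1) _ _ assms(2)])
    show "0 < 1 / U" using LU by simp
    show "1 / U \<le> 1 / dens q x r \<and> 1 / dens q x r \<le> 1 / L" if "M \<le> r" "r \<le> M'" for r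
      using LU(3)[OF that] LU(1) by (intro conjI divide_left_mono mult_pos_pos) auto
  qed (simp add: dens_pos)
qed

lemma almost_decreasing_dens_iff:
  "almost_increasing_upto M (\<lambda>r. 1 / dens q x r) \<longleftrightarrow>
    (\<exists>C>0. \<forall>r R. 0 < r \<and> r \<le> R \<and> R \<le> M \<longrightarrow> dens q x R \<le> C * dens q x r)"
proof -
  have "1 / dens q x r \<le> C * (1 / dens q x R) \<longleftrightarrow> dens q x R \<le> C * dens q x r"
    if "0 < r" "r \<le> R" for C r R
    using that dens_pos[of r q x] dens_pos[of R q x] by (auto simp: field_simps)
  then show ?thesis unfolding almost_increasing_upto_def by (intro ex_cong1 conj_cong refl) auto
qed

lemma emeasure_ball_div_powr:
  "0 < r \<Longrightarrow> emeasure \<nu> (ball x r) / ennreal (r powr s) = ennreal (dens s x r)"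
  by (simp add: emeasure_ball divide_ennreal dens_def)

text \<open>Separating the two radii in the ratio bound turns it into almost monotonicity of the
  density.\<close>

lemma lower_Q0_iff: "q \<in> lower_Q0 \<nu> x \<longleftrightarrow> 0 < q \<and> almost_increasing_upto 1 (dens q x)"
proof -
  have ratio: "emeasure \<nu> (ball x r) / emeasure \<nu> (ball x R) \<le> ennreal C * ennreal ((r / R) powr q)
      \<longleftrightarrow> dens q x r \<le> C * dens q x R" if "0 < r" "0 < R" "0 < C" for r R C
    using that m_pos[of r x] m_pos[of R x]
    by (simp add: emeasure_ball divide_ennreal ennreal_mult[symmetric] powr_divide dens_def field_simps)
  have "(\<exists>C>0. \<forall>r R. 0 < r \<and> r < R \<and> R \<le> 1 \<longrightarrow> dens q x r \<le> C * dens q x R)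
      \<longleftrightarrow> almost_increasing_upto 1 (dens q x)" (is "?L \<longleftrightarrow> _")
  proof
    assume ?L
    then obtain C where C: "0 < C" "\<And>r R. 0 < r \<Longrightarrow> r < R \<Longrightarrow> R \<le> 1 \<Longrightarrow> dens q x r \<le> C * dens q x R"
      by blast
    \<comment> \<open>The summand 1 takes care of r = R, which lies outside the range of the
      exponent set.\<close>
    have "dens q x r \<le> (C + 1) * dens q x R" if "0 < r" "r \<le> R" "R \<le> 1" for r R
      using C(2)[of r R] C(1) that dens_pos[of R q x] by (cases "r = R") (auto simp: distrib_right)
    then show "almost_increasing_upto 1 (dens q x)"
      unfolding almost_increasing_upto_def using C(1) by (intro exI[of _ "C + 1"]) auto
  qed (force simp: almost_increasing_upto_def)
  moreover have "q \<in> lower_Q0 \<nu> x \<longleftrightarrow> 0 < q \<and> ?L"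
    unfolding lower_Q0_def lesssim_def using ratio by (auto 0 4)
  ultimately show ?thesis by simp
qed

lemma upper_Q0_iff: "q \<in> upper_Q0 \<nu> x \<longleftrightarrow> 0 < q \<and> almost_increasing_upto 1 (\<lambda>r. 1 / dens q x r)"
proof -
  have ratio: "ennreal ((r / R) powr q) \<le> ennreal C * (emeasure \<nu> (ball x r) / emeasure \<nu> (ball x R))
      \<longleftrightarrow> dens q x R \<le> C * dens q x r" if "0 < r" "0 < R" "0 < C" for r R C
    using that m_pos[of r x] m_pos[of R x]
    by (simp add: emeasure_ball divide_ennreal ennreal_mult[symmetric] powr_divide dens_def field_simps)
  have "(\<exists>C>0. \<forall>r R. 0 < r \<and> r < R \<and> R \<le> 1 \<longrightarrow> dens q x R \<le> C * dens q x r)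
      \<longleftrightarrow> almost_increasing_upto 1 (\<lambda>r. 1 / dens q x r)" (is "?L \<longleftrightarrow> _")
    unfolding almost_decreasing_dens_iff
  proof
    assume ?L
    then obtain C where C: "0 < C" "\<And>r R. 0 < r \<Longrightarrow> r < R \<Longrightarrow> R \<le> 1 \<Longrightarrow> dens q x R \<le> C * dens q x r"
      by blast
    have "dens q x R \<le> (C + 1) * dens q x r" if "0 < r" "r \<le> R" "R \<le> 1" for r R
      using C(2)[of r R] C(1) that dens_pos[of r q x] by (cases "r = R") (auto simp: distrib_right)
    then show "\<exists>C>0. \<forall>r R. 0 < r \<and> r \<le> R \<and> R \<le> 1 \<longrightarrow> dens q x R \<le> C * dens q x r"
      using C(1) by (intro exI[of _ "C + 1"]) auto
  qed force
  moreover have "q \<in> upper_Q0 \<nu> x \<longleftrightarrow> 0 < q \<and> ?L"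
    unfolding upper_Q0_def gtrsim_def lesssim_def using ratio by (auto 0 4)
  ultimately show ?thesis by simp
qed

end

section \<open>Two-sided capacity estimates for concentric balls\<close>

text \<open>The assumption \<open>far\<close> is the form in which uniform perfectness and the
  diameter bound enter.\<close>

locale besov_ball_capacity = doubling_space \<nu> D
  for \<nu> :: "'a::complete_space measure" and D :: real +
  fixes x :: 'a and p \<theta> R0 K :: real
  assumes p: "1 \<le> p" and \<theta>: "0 < \<theta>" "\<theta> < 1" and R0: "0 < R0" and K: "0 < K"
    and far: "\<forall>R. 0 < R \<and> R \<le> R0 \<longrightarrow> (\<exists>z. 3 / 2 * R \<le> dist x z \<and> dist x z \<le> K * R)"
begin

definition s :: real where "s = \<theta> * p"

abbreviation cap :: "real \<Rightarrow> real \<Rightarrow> ennreal" where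
  "cap r R \<equiv> besov_cap \<nu> \<theta> p (ball x r) (ball x R)"

lemma s_bounds: "0 < s" "s < p"
  using p \<theta> by (auto simp: s_def)

lemma cap_upper:
  obtains C where "0 < C" "\<And>r \<rho> R. 0 < \<rho> \<Longrightarrow> r \<le> \<rho> \<Longrightarrow> 2 * \<rho> \<le> R \<Longrightarrow> cap r R \<le> ennreal (C * dens s x \<rho>)"
  using besov_cap_le[OF p \<theta>] unfolding s_def by blast

lemma dens_le_dens_double:
  assumes "0 < r" "r \<le> R" "R \<le> 2 * r"
  shows "dens s x r \<le> 2 powr s * dens s x R"
proof -
  have "R powr s \<le> (2 * r) powr s" using assms s_bounds by (intro powr_mono2) auto
  then have "R powr s \<le> 2 powr s * r powr s" by (simp add: powr_mult)
  then have "m x r / r powr s \<le> 2 powr s * m x r / R powr s"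
    using assms by (simp add: field_simps mult_left_mono)
  also have "\<dots> \<le> 2 powr s * m x R / R powr s"
    using assms by (intro divide_right_mono mult_left_mono m_mono) auto
  finally show ?thesis by (simp add: dens_def)
qed

definition radii :: "(real \<times> real) set" where
  "radii = {(r, R). 0 < 2 * r \<and> 2 * r \<le> R \<and> R \<le> R0}"

lemma cap_lesssim_small: "lesssim radii cap (\<lambda>r R. ennreal (dens s x r))"
proof -
  obtain C where C: "0 < C" "\<And>r \<rho> R. 0 < \<rho> \<Longrightarrow> r \<le> \<rho> \<Longrightarrow> 2 * \<rho> \<le> R \<Longrightarrow> cap r R \<le> ennreal (C * dens s x \<rho>)"
    by (rule cap_upper) blast
  then have "cap r R \<le> ennreal C * ennreal (dens s x r)" if "(r, R) \<in> radii" for r R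
    using C(2)[of r r R] that by (simp add: radii_def ennreal_mult' less_imp_le)
  with C(1) show ?thesis unfolding lesssim_def by blast
qed

lemma cap_lesssim_large: "lesssim radii cap (\<lambda>r R. ennreal (dens s x R))"
proof -
  obtain C where C: "0 < C" "\<And>r \<rho> R. 0 < \<rho> \<Longrightarrow> r \<le> \<rho> \<Longrightarrow> 2 * \<rho> \<le> R \<Longrightarrow> cap r R \<le> ennreal (C * dens s x \<rho>)"
    by (rule cap_upper) blast
  have "cap r R \<le> ennreal (C * 2 powr s) * ennreal (dens s x R)" if "(r, R) \<in> radii" for r R
  proof -
    have r: "0 < r" "2 * r \<le> R" using that by (auto simp: radii_def)
    have "cap r R \<le> ennreal (C * dens s x (R / 2))" using r by (intro C(2)) auto
    also have "\<dots> \<le> ennreal (C * (2 powr s * dens s x R))"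
      using r C(1) by (intro ennreal_leI mult_left_mono dens_le_dens_double) auto
    also have "\<dots> = ennreal (C * 2 powr s) * ennreal (dens s x R)"
      using r C(1) dens_pos[of R s x] by (simp add: ennreal_mult[symmetric] mult.assoc)
    finally show ?thesis .
  qed
  moreover have "0 < C * 2 powr s" using C(1) by simp
  ultimately show ?thesis unfolding lesssim_def by blast
qed

text \<open>Reduces a lower bound for the capacity to a choice of weights whose sums are bounded
  independently of N. The weights may depend on N so that their decay can be counted from either end
  of the range of scales.\<close>

lemma gtrsim_capI:
  assumes c: "0 < c"
    and w: "\<And>N k. 0 \<le> w N k" "\<And>N. (\<Sum>k\<le>N. w N k) \<le> W" "0 < W"
    and F: "\<And>r R N k. 0 < r \<Longrightarrow> r \<le> R \<Longrightarrow> R \<le> R0 \<Longrightarrow> R \<le> 2 ^ N * r \<Longrightarrow> 2 ^ N * r \<le> 2 * R \<Longrightarrow>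
      k \<le> N \<Longrightarrow> c * F r R \<le> w N k powr p * dens s x (2 ^ k * r)"
  shows "gtrsim radii cap (\<lambda>r R. ennreal (F r R))"
proof -
  obtain c1 where c1: "0 < c1" and scale: "\<forall>r R N u w W. 0 < r \<and> r \<le> R \<and> R \<le> R0 \<and> R \<le> 2 ^ N * r \<and>
      2 ^ N * r \<le> 2 * R \<and> u \<in> admissible (ball x r) (ball x R) \<and> (\<forall>k. 0 \<le> w k) \<and>
      (\<Sum>k\<le>N. w k) \<le> W \<and> 0 < W \<longrightarrow>
      (\<exists>k\<le>N. ennreal (c1 * (w k / W) powr p * dens s x (2 ^ k * r)) \<le> energy s p u)"
    using energy_ge_some_scale[OF p s_bounds(1) K far] by (elim exE conjE)
  define c' where "c' = c1 / W powr p * c"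
  have c': "0 < c'" using c c1 w by (simp add: c'_def)
  have "ennreal (F r R) \<le> ennreal (1 / c') * cap r R" if "(r, R) \<in> radii" for r R
  proof -
    have r: "0 < r" "r \<le> R" "R \<le> R0" using that by (auto simp: radii_def)
    obtain N where N: "R \<le> 2 ^ N * r" "2 ^ N * r \<le> 2 * R" using dyadic_scale_between[OF r(1,2)] by blast
    have "ennreal (c' * F r R) \<le> energy s p u" if u: "u \<in> admissible (ball x r) (ball x R)" for u
    proof -
      obtain k where k: "k \<le> N" "ennreal (c1 * (w N k / W) powr p * dens s x (2 ^ k * r)) \<le> energy s p u"
        using scale[rule_format, of r R N u "w N" W] r N u w by blast
      have "c' * F r R = c1 / W powr p * (c * F r R)" by (simp add: c'_def)
      also have "\<dots> \<le> c1 / W powr p * (w N k powr p * dens s x (2 ^ k * r))"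
        using c1 by (intro mult_left_mono F r N k) auto
      also have "\<dots> = c1 * (w N k / W) powr p * dens s x (2 ^ k * r)"
        by (simp add: powr_divide)
      finally show ?thesis using k(2) by (meson ennreal_leI order_trans)
    qed
    then have "ennreal (c' * F r R) \<le> cap r R"
      unfolding besov_cap_eq[OF p] s_def by (intro INF_greatest) (simp add: s_def)
    then show ?thesis by (rule ennreal_le_mult_of_mult_le[OF c'])
  qed
  moreover have "0 < 1 / c'" using c' by simp
  ultimately show ?thesis unfolding gtrsim_def lesssim_def by blast
qed

text \<open>As \<open>dens q x\<close> is almost increasing, \<open>dens s x\<close> grows at least
  like \<open>(2 ^ k) powr (q - s)\<close> from r to \<open>2 ^ k * r\<close>. With \<delta> = (q -
  s) / p the p-th powers of the weights use up exactly this growth, and the weights are still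
  summable.\<close>

lemma cap_gtrsim_small:
  assumes q: "s < q" "q \<in> lower_Q0 \<nu> x"
  shows "gtrsim radii cap (\<lambda>r R. ennreal (dens s x r))"
proof -
  \<comment> \<open>The largest dyadic radius \<open>2 ^ N * r\<close> may exceed R0, but not 2 *
    R0.\<close>
  have "almost_increasing_upto (2 * R0) (dens q x)"
    by (rule dens_almost_increasing_extend[of 1]) (use q in \<open>auto simp: lower_Q0_iff\<close>)
  then obtain C where C: "0 < C"
      "\<And>r R. 0 < r \<Longrightarrow> r \<le> R \<Longrightarrow> R \<le> 2 * R0 \<Longrightarrow> dens q x r \<le> C * dens q x R"
    by (rule almost_increasing_uptoD) blast
  define \<delta> where "\<delta> = (q - s) / p"
  have \<delta>: "0 < \<delta>" using q p by (simp add: \<delta>_def)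
  show ?thesis
  proof (rule gtrsim_capI[where c = "1 / C" and w = "\<lambda>N k. 2 powr (- (real k * \<delta>))" and W = "1 / (1 - 2 powr - \<delta>)"])
    show "(\<Sum>k\<le>N. 2 powr (- (real k * \<delta>))) \<le> 1 / (1 - 2 powr - \<delta>)" for N
      by (rule sum_powr_geometric_le[OF \<delta>])
    show "0 < 1 / (1 - (2::real) powr - \<delta>)" using two_powr_neg_less_1[OF \<delta>] by simp
    fix r R :: real and N k :: nat
    assume r: "0 < r" "r \<le> R" "R \<le> R0" "R \<le> 2 ^ N * r" "2 ^ N * r \<le> 2 * R" "k \<le> N"
    have rk: "0 < 2 ^ k * r" "r \<le> 2 ^ k * r" using r by auto
    have "(2::real) ^ k \<le> 2 ^ N" using r by (intro power_increasing) auto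
    then have "2 ^ k * r \<le> 2 ^ N * r" using r by (intro mult_right_mono) auto
    then have "2 ^ k * r \<le> 2 * R0" using r by linarith
    then have "dens q x r \<le> C * dens q x (2 ^ k * r)" using r rk by (intro C(2)) auto
    then have "1 / C * (r powr (q - s) * dens q x r) \<le> r powr (q - s) * dens q x (2 ^ k * r)"
      using C(1) mult_left_mono[of "dens q x r" "C * dens q x (2 ^ k * r)" "r powr (q - s)"]
      by (simp add: field_simps)
    also have "r powr (q - s) * dens q x r = dens s x r"
      using dens_powr_shift[OF r(1), of "q - s" q x] by simp
    also have "r powr (q - s) * dens q x (2 ^ k * r)
        = (2 powr (- (real k * \<delta>))) powr p * ((2 ^ k * r) powr (q - s) * dens q x (2 ^ k * r))"
    proof -
      have "(2 powr (- (real k * \<delta>))) powr p = inverse (2 powr (real k * (q - s)))"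
        using p by (simp add: \<delta>_def powr_powr powr_minus[symmetric])
      moreover have "(2 ^ k * r) powr (q - s) = 2 powr (real k * (q - s)) * r powr (q - s)"
        by (simp add: powr_mult powr_realpow[symmetric] powr_powr)
      ultimately show ?thesis by simp
    qed
    also have "(2 ^ k * r) powr (q - s) * dens q x (2 ^ k * r) = dens s x (2 ^ k * r)"
      using dens_powr_shift[OF rk(1), of "q - s" q x] by simp
    finally show "1 / C * dens s x r \<le> (2 powr (- (real k * \<delta>))) powr p * dens s x (2 ^ k * r)" .
  qed (use C in auto)
qed

text \<open>The mirror image: q < s makes \<open>dens s x\<close> grow inwards from the outer
  radius, so the weights decay in N - k.\<close>

lemma cap_gtrsim_large:
  assumes q: "q < s" "q \<in> upper_Q0 \<nu> x"
  shows "gtrsim radii cap (\<lambda>r R. ennreal (dens s x R))"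
proof -
  have "almost_increasing_upto (2 * R0) (\<lambda>r. 1 / dens q x r)"
    by (rule dens_almost_decreasing_extend[of 1]) (use q in \<open>auto simp: upper_Q0_iff\<close>)
  then obtain C where C: "0 < C"
      "\<And>r R. 0 < r \<Longrightarrow> r \<le> R \<Longrightarrow> R \<le> 2 * R0 \<Longrightarrow> dens q x R \<le> C * dens q x r"
    unfolding almost_decreasing_dens_iff by blast
  define \<delta> where "\<delta> = (s - q) / p"
  have \<delta>: "0 < \<delta>" using q p by (simp add: \<delta>_def)
  show ?thesis
  proof (rule gtrsim_capI[where c = "1 / (2 powr s * C)" and w = "\<lambda>N k. 2 powr (- (real (N - k) * \<delta>))"
        and W = "1 / (1 - 2 powr - \<delta>)"])
    show "(\<Sum>k\<le>N. 2 powr (- (real (N - k) * \<delta>))) \<le> 1 / (1 - 2 powr - \<delta>)" for N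
      using sum_powr_geometric_le[OF \<delta>, of N]
        sum.nat_diff_reindex[of "\<lambda>k. 2 powr (- (real k * \<delta>))" "Suc N"]
      by (simp add: lessThan_Suc_atMost)
    show "0 < 1 / (1 - (2::real) powr - \<delta>)" using two_powr_neg_less_1[OF \<delta>] by simp
    fix r R :: real and N k :: nat
    assume r: "0 < r" "r \<le> R" "R \<le> R0" "R \<le> 2 ^ N * r" "2 ^ N * r \<le> 2 * R" "k \<le> N"
    have rk: "0 < 2 ^ k * r" and rN: "0 < 2 ^ N * r" using r by auto
    have "(2::real) ^ k \<le> 2 ^ N" using r by (intro power_increasing) auto
    then have "2 ^ k * r \<le> 2 ^ N * r" using r by (intro mult_right_mono) auto
    then have le: "dens q x (2 ^ N * r) \<le> C * dens q x (2 ^ k * r)" using r rk by (intro C(2)) auto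
    \<comment> \<open>Replaces R by the outermost dyadic radius, which lies between R and 2 *
      R.\<close>
    have "dens s x R \<le> 2 powr s * dens s x (2 ^ N * r)"
      using r by (intro dens_le_dens_double) auto
    also have "dens s x (2 ^ N * r) = (2 ^ N * r) powr (q - s) * dens q x (2 ^ N * r)"
      using dens_powr_shift[OF rN, of "q - s" q x] by simp
    also have "2 powr s * \<dots> \<le> 2 powr s * ((2 ^ N * r) powr (q - s) * (C * dens q x (2 ^ k * r)))"
      using le by (intro mult_left_mono) auto
    also have "(2 ^ N * r) powr (q - s)
        = (2 powr (- (real (N - k) * \<delta>))) powr p * (2 ^ k * r) powr (q - s)"
    proof -
      have "2 ^ N * r = 2 ^ (N - k) * (2 ^ k * r)"
        using r(6) by (simp add: power_add[symmetric] mult.assoc[symmetric])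
      then have "(2 ^ N * r) powr (q - s) = (2 ^ (N - k)) powr (q - s) * (2 ^ k * r) powr (q - s)"
        by (simp only: powr_mult)
      also have "((2::real) ^ (N - k)) powr (q - s) = (2 powr (- (real (N - k) * \<delta>))) powr p"
        using p by (simp add: \<delta>_def powr_powr powr_realpow[symmetric] minus_divide_left[symmetric] right_diff_distrib)
      finally show ?thesis .
    qed
    also have "2 powr s * ((2 powr (- (real (N - k) * \<delta>))) powr p * (2 ^ k * r) powr (q - s) * (C * dens q x (2 ^ k * r)))
      = 2 powr s * C * ((2 powr (- (real (N - k) * \<delta>))) powr p * ((2 ^ k * r) powr (q - s) * dens q x (2 ^ k * r)))"
      by (simp only: mult_ac)
    also have "(2 ^ k * r) powr (q - s) * dens q x (2 ^ k * r) = dens s x (2 ^ k * r)"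
      using dens_powr_shift[OF rk, of "q - s" q x] by simp
    finally show "1 / (2 powr s * C) * dens s x R \<le> (2 powr (- (real (N - k) * \<delta>))) powr p * dens s x (2 ^ k * r)"
      using C(1) by (simp add: pos_divide_le_eq mult_ac)
  qed (use C in auto)
qed

section \<open>From capacity bounds back to exponents\<close>

text \<open>Eliminates the capacity: the assumed lower bound is set against the upper bound from a
  cutoff at an arbitrary intermediate radius.\<close>

lemma gtrsim_cap_D:
  assumes "gtrsim radii cap (\<lambda>r R. ennreal (F r R))"
  obtains C where "0 < C" "\<And>r \<rho> R. 0 < r \<Longrightarrow> r \<le> \<rho> \<Longrightarrow> 2 * \<rho> \<le> R \<Longrightarrow> R \<le> R0 \<Longrightarrow> F r R \<le> C * dens s x \<rho>"
proof -
  obtain C1 where C1: "0 < C1" "\<And>r R. (r, R) \<in> radii \<Longrightarrow> ennreal (F r R) \<le> ennreal C1 * cap r R"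
    using assms unfolding gtrsim_def lesssim_def by blast
  obtain C2 where C2: "0 < C2" "\<And>r \<rho> R. 0 < \<rho> \<Longrightarrow> r \<le> \<rho> \<Longrightarrow> 2 * \<rho> \<le> R \<Longrightarrow> cap r R \<le> ennreal (C2 * dens s x \<rho>)"
    by (rule cap_upper) blast
  show ?thesis
  proof
    show "0 < C1 * C2" using C1 C2 by simp
    fix r \<rho> R assume r: "0 < r" "r \<le> \<rho>" "2 * \<rho> \<le> R" "R \<le> R0"
    have "ennreal (F r R) \<le> ennreal C1 * cap r R" using r by (intro C1(2)) (auto simp: radii_def)
    also have "\<dots> \<le> ennreal C1 * ennreal (C2 * dens s x \<rho>)" using r by (intro mult_left_mono C2(2)) auto
    finally have "ennreal (F r R) \<le> ennreal (C1 * (C2 * dens s x \<rho>))"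
      using C1(1) C2(1) dens_pos[of \<rho> s x] r by (simp add: ennreal_mult)
    then show "F r R \<le> C1 * C2 * dens s x \<rho>"
      using C1(1) C2(1) dens_pos[of \<rho> s x] r by (subst (asm) ennreal_le_iff) (auto simp: mult.assoc)
  qed
qed

lemma lower_Q0_of_gtrsim:
  assumes "gtrsim radii cap (\<lambda>r R. ennreal (dens s x r))"
  shows "s \<in> lower_Q0 \<nu> x"
proof -
  obtain C where C: "0 < C"
    "\<And>r \<rho> R. 0 < r \<Longrightarrow> r \<le> \<rho> \<Longrightarrow> 2 * \<rho> \<le> R \<Longrightarrow> R \<le> R0 \<Longrightarrow> dens s x r \<le> C * dens s x \<rho>"
    by (rule gtrsim_cap_D[OF assms]) blast
  \<comment> \<open>With the outer radius fixed at R0, the intermediate radius can run up to R0 /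
    2.\<close>
  have "almost_increasing_upto (R0 / 2) (dens s x)"
    unfolding almost_increasing_upto_def using C(1)
    by (intro exI[of _ C]) (auto intro!: C(2)[where R = R0])
  then have "almost_increasing_upto 1 (dens s x)"
    by (rule dens_almost_increasing_extend[of "R0 / 2"]) (use R0 s_bounds in auto)
  then show ?thesis using s_bounds by (simp add: lower_Q0_iff)
qed

lemma almost_decreasing_of_gtrsim:
  assumes "gtrsim radii cap (\<lambda>r R. ennreal (dens s x R))"
  shows "almost_increasing_upto M (\<lambda>r. 1 / dens s x r)"
proof -
  obtain C where C: "0 < C"
    "\<And>r \<rho> R. 0 < r \<Longrightarrow> r \<le> \<rho> \<Longrightarrow> 2 * \<rho> \<le> R \<Longrightarrow> R \<le> R0 \<Longrightarrow> dens s x R \<le> C * dens s x \<rho>"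
    by (rule gtrsim_cap_D[OF assms]) blast
  \<comment> \<open>The outer radius must be at least twice the intermediate one, so R is first
    doubled; the intermediate radius is then taken to be r.\<close>
  have "dens s x R \<le> 2 powr s * C * dens s x r" if "0 < r" "r \<le> R" "R \<le> R0 / 2" for r R
  proof -
    have "dens s x R \<le> 2 powr s * dens s x (2 * R)" using that by (intro dens_le_dens_double) auto
    also have "\<dots> \<le> 2 powr s * (C * dens s x r)" using that by (intro mult_left_mono C(2)[of r]) auto
    finally show ?thesis by simp
  qed
  moreover have "0 < 2 powr s * C" using C(1) by simp
  ultimately have "almost_increasing_upto (R0 / 2) (\<lambda>r. 1 / dens s x r)"
    unfolding almost_decreasing_dens_iff by blast
  then show ?thesis
    by (rule dens_almost_decreasing_extend[of "R0 / 2"]) (use R0 s_bounds in auto)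
qed

lemma upper_Q0_of_gtrsim:
  assumes "gtrsim radii cap (\<lambda>r R. ennreal (dens s x R))"
  shows "s \<in> upper_Q0 \<nu> x"
  using almost_decreasing_of_gtrsim[OF assms] s_bounds by (simp add: upper_Q0_iff)

text \<open>For \<open>p > 1\<close> the logarithmic cutoff over \<open>n\<close> dyadic scales gains a factor \<open>n powr (1 - p)\<close>, which beats
  the constants for large \<open>n\<close>; iteration turns this gain into a power of the radius.\<close>

lemma dens_halving_of_gtrsim:
  assumes "gtrsim radii cap (\<lambda>r R. ennreal (dens s x R))" "1 < p"
  shows "\<exists>n>0. \<forall>r. 0 < r \<and> 2 ^ n * r \<le> R0 \<longrightarrow> dens s x (2 ^ n * r) \<le> dens s x r / 2"
proof -
  obtain C1 where C1: "0 < C1" "\<And>r R. (r, R) \<in> radii \<Longrightarrow> ennreal (dens s x R) \<le> ennreal C1 * cap r R"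
    using assms(1) unfolding gtrsim_def lesssim_def by blast
  obtain C2 where C2: "0 < C2" "\<And>x r n. 0 < r \<Longrightarrow> 0 < n \<Longrightarrow>
      energy s p (log_cutoff x r n) \<le> ennreal (C2 / real n powr p * (\<Sum>k<n. dens s x (2 ^ k * r)))"
    using log_cutoff_energy_le[OF assms(2) s_bounds] by blast
  obtain C3 where C3: "0 < C3" "\<And>r R. 0 < r \<Longrightarrow> r \<le> R \<Longrightarrow> R \<le> R0 \<Longrightarrow> dens s x R \<le> C3 * dens s x r"
    using almost_decreasing_of_gtrsim[OF assms(1), of R0] unfolding almost_decreasing_dens_iff by blast
  define C where "C = C1 * C2 * C3"
  have C: "0 < C" using C1 C2 C3 by (simp add: C_def)
  \<comment> \<open>Testing the capacity with the logarithmic cutoff gives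
    \<open>real n powr - p\<close> times a sum of n densities, each at most
    \<open>C3 * dens s x r\<close> because the density is almost decreasing.\<close>
  have main: "dens s x (2 ^ n * r) \<le> C * real n powr (1 - p) * dens s x r"
    if r: "0 < r" and n: "0 < n" and R: "2 ^ n * r \<le> R0" for r and n :: nat
  proof -
    have two: "(2::real) \<le> 2 ^ n" using n by (cases n) auto
    have "2 * r \<le> 2 ^ n * r" using two r by (intro mult_right_mono) auto
    then have "(r, 2 ^ n * r) \<in> radii" using r R by (simp add: radii_def)
    then have "ennreal (dens s x (2 ^ n * r)) \<le> ennreal C1 * cap r (2 ^ n * r)" by (rule C1(2))
    also have "\<dots> \<le> ennreal C1 * energy s p (log_cutoff x r n)"
      unfolding besov_cap_eq[OF p] s_def
      by (intro mult_left_mono INF_lower log_cutoff_admissible r n) auto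
    also have "\<dots> \<le> ennreal C1 * ennreal (C2 / real n powr p * (\<Sum>k<n. dens s x (2 ^ k * r)))"
      by (intro mult_left_mono C2 r n) auto
    also have "\<dots> = ennreal (C1 * (C2 / real n powr p * (\<Sum>k<n. dens s x (2 ^ k * r))))"
      by (rule ennreal_mult'[symmetric]) (use C1 in simp)
    also have "\<dots> \<le> ennreal (C1 * (C2 / real n powr p * (real n * (C3 * dens s x r))))"
    proof (intro ennreal_leI mult_left_mono)
      have "dens s x (2 ^ k * r) \<le> C3 * dens s x r" if "k < n" for k
      proof (rule C3(2))
        have "(2::real) ^ k \<le> 2 ^ n" using that by (intro power_increasing) auto
        then have "2 ^ k * r \<le> 2 ^ n * r" using r by (intro mult_right_mono) auto
        then show "2 ^ k * r \<le> R0" using R by simp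
      qed (use r in auto)
      then show "(\<Sum>k<n. dens s x (2 ^ k * r)) \<le> real n * (C3 * dens s x r)"
        using sum_bounded_above[of "{..<n}" "\<lambda>k. dens s x (2 ^ k * r)" "C3 * dens s x r"] by simp
    qed (use C1 C2 in auto)
    finally have "dens s x (2 ^ n * r) \<le> C1 * (C2 / real n powr p * (real n * (C3 * dens s x r)))"
      using C1 C2 C3 dens_pos[OF r, of s x] by (subst (asm) ennreal_le_iff) (auto simp: less_imp_le)
    also have "\<dots> = C * real n powr (1 - p) * dens s x r"
      using n by (simp add: C_def powr_diff)
    finally show ?thesis .
  qed
  \<comment> \<open>Chosen to make \<open>C * real n powr (1 - p)\<close> at most 1/2; this is where
    p > 1 is essential.\<close>
  obtain n :: nat where n: "(2 * C) powr (1 / (p - 1)) < real n" using reals_Archimedean2 by blast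
  have n0: "0 < n" using n powr_ge_zero[of "2 * C" "1 / (p - 1)"] by (cases n) auto
  have "2 * C = ((2 * C) powr (1 / (p - 1))) powr (p - 1)" using assms(2) C by (simp add: powr_powr)
  also have "\<dots> \<le> real n powr (p - 1)" using n assms(2) by (intro powr_mono2) auto
  finally have "C * real n powr (1 - p) \<le> 1 / 2"
    using n0 by (simp add: powr_diff field_simps)
  then have half: "C * real n powr (1 - p) * dens s x r \<le> 1 / 2 * dens s x r" if "0 < r" for r
    using dens_pos[OF that, of s x] by (intro mult_right_mono) auto
  have "dens s x (2 ^ n * r) \<le> dens s x r / 2" if "0 < r" "2 ^ n * r \<le> R0" for r
    using main[OF that(1) n0 that(2)] half[OF that(1)] by linarith
  with n0 show ?thesis by blast
qed

text \<open>Lowering the exponent from s to s - e multiplies the change over a factor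
  \<open>L = 2 ^ n\<close> of the radius by \<open>L powr e\<close>. As long as this is at most 2,
  the halving compensates for it, and the density with the smaller exponent still does not
  increase.\<close>

lemma upper_Q0_self_improvement:
  assumes "gtrsim radii cap (\<lambda>r R. ennreal (dens s x R))" "1 < p"
  shows "\<exists>q<s. q \<in> upper_Q0 \<nu> x"
proof -
  obtain n where n: "0 < n" "\<And>r. 0 < r \<Longrightarrow> 2 ^ n * r \<le> R0 \<Longrightarrow> dens s x (2 ^ n * r) \<le> dens s x r / 2"
    using dens_halving_of_gtrsim[OF assms] by blast
  define L where "L = (2::real) ^ n"
  have L: "1 < L" using n(1) by (simp add: L_def)
  \<comment> \<open>The first entry gives \<open>L powr e \<le> 2\<close>, the second keeps s - e
    positive.\<close>
  define e where "e = min (1 / real n) (s / 2)"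
  have e: "0 < e" "e < s" "e * real n \<le> 1"
    using n(1) s_bounds by (auto simp: e_def min_def field_simps)
  have Le: "L powr e \<le> 2"
  proof -
    have "L powr e = 2 powr (e * real n)" by (simp add: L_def powr_realpow[symmetric] powr_powr mult.commute)
    also have "\<dots> \<le> 2 powr 1" using e by (intro powr_mono) auto
    finally show ?thesis by simp
  qed
  have step: "dens (s - e) x (L * r) \<le> dens (s - e) x r" if r: "0 < r" "L * r \<le> R0" for r
  proof -
    have "dens (s - e) x (L * r) = (L powr e * r powr e) * dens s x (L * r)"
      using dens_powr_shift[of "L * r" e s x] r L by (simp add: powr_mult)
    also have "\<dots> \<le> (2 * r powr e) * (dens s x r / 2)"
      using n(2)[of r] r Le L dens_pos[of "L * r" s x] by (intro mult_mono) (auto simp: L_def[symmetric] less_imp_le)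
    also have "\<dots> = dens (s - e) x r" using dens_powr_shift[of r e s x] r by simp
    finally show ?thesis .
  qed
  have one: "dens (s - e) x R \<le> D ^ n * dens (s - e) x r" if r: "0 < r" "r \<le> R" "R \<le> L * r" for r R
  proof -
    have "m x R \<le> D ^ n * m x r"
      using m_mono[OF r(3), of x] m_double_power[OF r(1), of x n] by (simp add: L_def)
    then have "m x R / R powr (s - e) \<le> D ^ n * m x r / r powr (s - e)"
      using r e D_gt_1 by (intro frac_le powr_mono2) auto
    then show ?thesis by (simp add: dens_def)
  qed
  \<comment> \<open>Steps by the factor L cost nothing; the last incomplete one is handled by
    \<open>one\<close>, so the constant \<open>D ^ n\<close> is paid once, whatever the number of
    steps.\<close>
  have iter: "dens (s - e) x R \<le> D ^ n * dens (s - e) x r"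
    if "0 < r" "r \<le> R" "R \<le> R0" "R \<le> L ^ Suc j * r" for j r R
    using that
  proof (induction j arbitrary: r)
    case 0
    then show ?case by (intro one) auto
  next
    case (Suc j)
    show ?case
    proof (cases "R \<le> L * r")
      case True
      then show ?thesis using Suc.prems by (intro one) auto
    next
      case False
      have "dens (s - e) x R \<le> D ^ n * dens (s - e) x (L * r)"
        using Suc.prems False L by (intro Suc.IH) (auto simp: mult_ac)
      also have "\<dots> \<le> D ^ n * dens (s - e) x r"
        using Suc.prems False D_gt_1 by (intro mult_left_mono step) auto
      finally show ?thesis .
    qed
  qed
  have "dens (s - e) x R \<le> D ^ n * dens (s - e) x r" if "0 < r" "r \<le> R" "R \<le> R0" for r R
  proof -
    obtain j where "R / r < L ^ j" using real_arch_pow[OF L] by blast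
    also have "L ^ j \<le> L ^ Suc j" using L by simp
    finally show ?thesis using that by (intro iter[of r R j]) (auto simp: field_simps)
  qed
  then have "almost_increasing_upto R0 (\<lambda>r. 1 / dens (s - e) x r)"
    unfolding almost_decreasing_dens_iff using D_gt_1 by (intro exI[of _ "D ^ n"]) auto
  then have "almost_increasing_upto 1 (\<lambda>r. 1 / dens (s - e) x r)"
    by (rule dens_almost_decreasing_extend[of R0]) (use R0 e in auto)
  then show ?thesis using e by (intro exI[of _ "s - e"]) (auto simp: upper_Q0_iff)
qed

section \<open>Formulation with the critical exponents\<close>

lemma simeq_small:
  assumes "ereal s < lower_q0 \<nu> x"
  shows "simeq radii cap (\<lambda>r R. ennreal (dens s x r))"
proof -
  obtain q where "q \<in> lower_Q0 \<nu> x" "s < q"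
    using assms unfolding lower_q0_def less_SUP_iff by auto
  then show ?thesis using cap_gtrsim_small cap_lesssim_small by (simp add: simeq_def)
qed

lemma simeq_large:
  assumes "upper_q0 \<nu> x < ereal s"
  shows "simeq radii cap (\<lambda>r R. ennreal (dens s x R))"
proof -
  obtain q where "q \<in> upper_Q0 \<nu> x" "q < s"
    using assms unfolding upper_q0_def INF_less_iff by auto
  then show ?thesis using cap_gtrsim_large cap_lesssim_large by (simp add: simeq_def)
qed

lemma upper_q0_less_of_gtrsim:
  assumes "gtrsim radii cap (\<lambda>r R. ennreal (dens s x R))" "1 < p"
  shows "upper_q0 \<nu> x < ereal s"
proof -
  obtain q where "q \<in> upper_Q0 \<nu> x" "q < s" using upper_Q0_self_improvement[OF assms] by blast
  then show ?thesis unfolding upper_q0_def INF_less_iff by auto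
qed

lemma emeasure_powr_cong:
  "simeq radii cap (\<lambda>r R. emeasure \<nu> (ball x r) / ennreal (r powr s)) = simeq radii cap (\<lambda>r R. ennreal (dens s x r))"
  "simeq radii cap (\<lambda>r R. emeasure \<nu> (ball x R) / ennreal (R powr s)) = simeq radii cap (\<lambda>r R. ennreal (dens s x R))"
  "gtrsim radii cap (\<lambda>r R. emeasure \<nu> (ball x r) / ennreal (r powr s)) = gtrsim radii cap (\<lambda>r R. ennreal (dens s x r))"
  "gtrsim radii cap (\<lambda>r R. emeasure \<nu> (ball x R) / ennreal (R powr s)) = gtrsim radii cap (\<lambda>r R. ennreal (dens s x R))"
proof -
  let ?r = "\<lambda>r R. emeasure \<nu> (ball x r) / ennreal (r powr s)" and ?r' = "\<lambda>r R. ennreal (dens s x r)"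
  let ?R = "\<lambda>r R. emeasure \<nu> (ball x R) / ennreal (R powr s)" and ?R' = "\<lambda>r R. ennreal (dens s x R)"
  have "lesssim radii cap ?r = lesssim radii cap ?r'" "lesssim radii ?r cap = lesssim radii ?r' cap"
    "lesssim radii cap ?R = lesssim radii cap ?R'" "lesssim radii ?R cap = lesssim radii ?R' cap"
    by (rule lesssim_cong; auto simp: radii_def intro!: emeasure_ball_div_powr)+
  note eqs = this
  show "simeq radii cap ?r = simeq radii cap ?r'" "simeq radii cap ?R = simeq radii cap ?R'"
    "gtrsim radii cap ?r = gtrsim radii cap ?r'" "gtrsim radii cap ?R = gtrsim radii cap ?R'"
    unfolding simeq_def gtrsim_def eqs by (rule refl)+
qed

end

theorem theorem1p2:
  fixes \<nu> :: "'a::complete_space measure" and x0 :: 'a and p \<theta> R0 :: real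
  assumes "\<exists>x y::'a. x \<noteq> y"
    and "doubling_measure \<nu>"
    and "uniformly_perfect_at x0"
    and "1 \<le> p" and "0 < \<theta>" and "\<theta> < 1"
    and "0 < R0" and "ereal R0 \<le> ediam (UNIV :: 'a set) / 4"
  shows
    "(ereal (\<theta> * p) < lower_q0 \<nu> x0 \<longrightarrow>
       simeq {(r, R). 0 < 2 * r \<and> 2 * r \<le> R \<and> R \<le> R0}
         (\<lambda>r R. besov_cap \<nu> \<theta> p (ball x0 r) (ball x0 R))
         (\<lambda>r R. emeasure \<nu> (ball x0 r) / ennreal (r powr (\<theta> * p)))) \<and>
     (ereal (\<theta> * p) > upper_q0 \<nu> x0 \<longrightarrow>
       simeq {(r, R). 0 < 2 * r \<and> 2 * r \<le> R \<and> R \<le> R0}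
         (\<lambda>r R. besov_cap \<nu> \<theta> p (ball x0 r) (ball x0 R))
         (\<lambda>r R. emeasure \<nu> (ball x0 R) / ennreal (R powr (\<theta> * p)))) \<and>
     (gtrsim {(r, R). 0 < 2 * r \<and> 2 * r \<le> R \<and> R \<le> R0}
         (\<lambda>r R. besov_cap \<nu> \<theta> p (ball x0 r) (ball x0 R))
         (\<lambda>r R. emeasure \<nu> (ball x0 r) / ennreal (r powr (\<theta> * p)))
       \<longrightarrow> \<theta> * p \<in> lower_Q0 \<nu> x0) \<and>
     (gtrsim {(r, R). 0 < 2 * r \<and> 2 * r \<le> R \<and> R \<le> R0}
         (\<lambda>r R. besov_cap \<nu> \<theta> p (ball x0 r) (ball x0 R))
         (\<lambda>r R. emeasure \<nu> (ball x0 R) / ennreal (R powr (\<theta> * p)))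
       \<longrightarrow> \<theta> * p \<in> upper_Q0 \<nu> x0) \<and>
     (1 < p \<longrightarrow>
       (simeq {(r, R). 0 < 2 * r \<and> 2 * r \<le> R \<and> R \<le> R0}
          (\<lambda>r R. besov_cap \<nu> \<theta> p (ball x0 r) (ball x0 R))
          (\<lambda>r R. emeasure \<nu> (ball x0 R) / ennreal (R powr (\<theta> * p)))
        \<longleftrightarrow> ereal (\<theta> * p) > upper_q0 \<nu> x0))"
proof -
  obtain D where D: "1 < D"
    "\<And>x r. 0 < r \<Longrightarrow> emeasure \<nu> (ball x (2 * r)) \<le> ennreal D * emeasure \<nu> (ball x r)"
    using assms(2) unfolding doubling_measure_def by blast
  obtain K where K: "0 < K"
    "\<forall>R. 0 < R \<and> R \<le> R0 \<longrightarrow> (\<exists>z. 3 / 2 * R \<le> dist x0 z \<and> dist x0 z \<le> K * R)"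
    using exists_comparably_distant_point[OF assms(3,7,8)] by blast
  interpret besov_ball_capacity \<nu> D x0 p \<theta> R0 K
  proof
    show "emeasure \<nu> (ball x r) < \<infinity>" for x r
      using assms(2) by (cases "0 < r") (auto simp: doubling_measure_def not_less ball_empty)
  qed (use assms D K in \<open>auto simp: doubling_measure_def\<close>)
  \<comment> \<open>The forward direction of the final equivalence comes from the lower bound
    contained in \<open>simeq\<close>.\<close>
  show ?thesis
    unfolding s_def[symmetric] radii_def[symmetric] emeasure_powr_cong
    using simeq_small simeq_large lower_Q0_of_gtrsim upper_Q0_of_gtrsim upper_q0_less_of_gtrsim
    by (auto simp: simeq_def)
qed

end
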